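(* Let $d=2$, $m\geq1$, $n=2+m$, and let $\mathcal P=\mathcal P(\mathcal W,\mathcal L)\subset\mathbb R^2$ be a regular cut-and-project set such that either $H_g=\mathrm{SL}(n,\mathbb R)$ or $H_g=\mathrm{ASL}(n,\mathbb R)$. Then $m_{\widehat{\mathcal P}}=0$.
   Context: The set of visible points of $\mathcal Q\subset\mathbb R^2$ is $\widehat{\mathcal Q}=\{\mathbf y\in\mathcal Q: t\mathbf y\notin\mathcal Q\ \forall t\in(0,1)\}$. $\mathcal Q$ has constant density $\theta(\mathcal Q)$ if $\lim_{T\to\infty}\#(\mathcal Q\cap T\mathcal D)/T^2=\theta(\mathcal Q)\,\mathrm{vol}(\mathcal D)$ for every bounded $\mathcal D\subset\mathbb R^2$ with boundary of Lebesgue measure zero. Cut-and-project sets (here $d=2$). Let $\pi:\mathbb R^n\to\mathbb R^d$ and $\pi_{\mathrm{int}}:\mathbb R^n\to\mathbb R^m$ be the projections onto the first $d$ and last $m$ coordinates. Let $\mathcal L=\mathcal L_0+\mathbf x\subset\mathbb R^n$ be a possibly affine lattice, where $\mathcal L_0$ is a lattice of full rank and $\mathbf x\in\mathbb R^n$. Let $\mathcal A_0=\overline{\pi_{\mathrm{int}}(\mathcal L_0)}$, a closed subgroup of $\mathbb R^m$, let $\mathcal A_0^\circ$ be its connected component of $\mathbf 0$ (a linear subspace, of dimension $m_1$ say), and let $\mathcal A=\overline{\pi_{\mathrm{int}}(\mathcal L)}=\mathcal A_0+\pi_{\mathrm{int}}(\mathbf x)$. Let $\mu_{\mathcal A}$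 be the translate to $\mathcal A$ of the Haar measure on $\mathcal A_0$, normalized so that its restriction to $\mathcal A_0^\circ$ is $m_1$-dimensional Lebesgue measure. The window $\mathcal W$ is a bounded subset of $\mathcal A$ with non-empty interior relative to $\mathcal A$, and $\mathcal P(\mathcal W,\mathcal L)=\{\pi(\mathbf y):\mathbf y\in\mathcal L,\ \pi_{\mathrm{int}}(\mathbf y)\in\mathcal W\}\subset\mathbb R^d$. It is assumed throughout that $\mathbf y\mapsto\pi(\mathbf y)$ is injective on $\{\mathbf y\in\mathcal L:\pi_{\mathrm{int}}(\mathbf y)\in\mathcal W\}$. The cut-and-project set is called regular if the boundary of $\mathcal W$ (relative to $\mathcal A$) has $\mu_{\mathcal A}$-measure zero. For regular $\mathcal P$, both $\mathcal P$ and $\widehat{\mathcal P}$ have constant density, with $0<\theta(\widehat{\mathcal P})\le\theta(\mathcal P)$; put $\kappa_{\mathcal P}=\theta(\widehat{\mathcal P})/\theta(\mathcal P)$. Random cut-and-project sets. Let $G=\mathrm{ASL}(n,\mathbb R)=\mathrm{SL}(n,\mathbb R)\ltimes\mathbb R^n$ with multiplication $(M,\boldsymbol\xi)(M',\boldsymbol\xi')=(MM',\boldsymbol\xi M'+\boldsymbol\xi')$, acting on row vectors by $\mathbf y(M,\boldsymbol\xi)=\mathbf yM+\boldsymbol\xi$ (and $\mathrm{SL}(n,\mathbb R)$ is identified with $\mathrm{SL}(n,\mathbb R)\times\{\mathbf 0\}\subset G$), and let $\Gamma=\mathrm{ASL}(n,\mathbb Z)$. Choose $g\in G$ and $\delta>0$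 with $\mathcal L=\delta^{1/n}(\mathbb Z^ng)$. For $A\in\mathrm{SL}(d,\mathbb R)$ let $\varphi_g(A)=g(\mathrm{diag}[A,1_m],\mathbf 0)g^{-1}\in G$. By Ratner's theorems there is a unique closed connected subgroup $H_g$ of $G$ such that $\Gamma\cap H_g$ is a lattice in $H_g$, $\varphi_g(\mathrm{SL}(d,\mathbb R))\subset H_g$, and the closure of $\Gamma\backslash\Gamma\varphi_g(\mathrm{SL}(d,\mathbb R))$ in $\Gamma\backslash G$ is $X:=\Gamma\backslash\Gamma H_g$. Let $\mu$ be the right-$H_g$-invariant probability measure on $X$. For $x=\Gamma h\in X$ ($h\in H_g$) set $\mathcal P^x=\mathcal P(\mathcal W,\delta^{1/n}(\mathbb Z^nhg))$ with set of visible points $\widehat{\mathcal P}^x$. For $\sigma>0$ let $\mathfrak C(\sigma)=\{(x_1,x_2)\in\mathbb R^2:0<x_1<1,\ |x_2|<\frac{\sigma}{\theta(\mathcal P)}x_1\}$ (and $\mathfrak C(0)=\emptyset$). Then $m_{\widehat{\mathcal P}}\ge0$ is the supremum of all $\sigma\geq0$ such that $\#(\widehat{\mathcal P}^x\cap\mathfrak C(\kappa_{\mathcal P}^{-1}\sigma))\leq1$ for $\mu$-almost all $x\in X$. *)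

theory Defs
  imports "HOL-Analysis.Analysis" "HOL-Probability.Probability_Measure" "HOL-Algebra.Coset"
begin

section \<open>Constant density and visible points\<close>

definition visible :: "(real^2) set \<Rightarrow> (real^2) set" where
  "visible Q = {y \<in> Q. \<forall>t\<in>{0<..<1}. t *\<^sub>R y \<notin> Q}"

text \<open>A finite limit of the normalised counts presupposes that the counts are finite. Since
  \<open>card\<close> is 0 on infinite sets, this has to be said separately.\<close>

definition has_constant_density :: "(real^2) set \<Rightarrow> real \<Rightarrow> bool" where
  "has_constant_density Q \<theta> \<longleftrightarrow>
     (\<forall>S. bounded S \<longrightarrow> finite (Q \<inter> S)) \<and>
     (\<forall>D. bounded D \<and> negligible (frontier D) \<longrightarrow>
        ((\<lambda>T. real (card (Q \<inter> (\<lambda>y. T *\<^sub>R y) ` D)) / T\<^sup>2) \<longlongrightarrow> \<theta> * measure lebesgue D) at_top)"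

definition density_of :: "(real^2) set \<Rightarrow> real" where
  "density_of Q = (THE \<theta>. has_constant_density Q \<theta>)"

definition kappa :: "(real^2) set \<Rightarrow> real" where
  "kappa P = density_of (visible P) / density_of P"

section \<open>Cut-and-project sets\<close>

text \<open>Euclidean space of dimension \<open>d + m\<close> is indexed by the sum type \<open>'d + 'm\<close>; the first
  \<open>d\<close> coordinates carry the indices \<open>Inl i\<close>, the last \<open>m\<close> ones the indices \<open>Inr j\<close>.\<close>

definition proj :: "real^('d::finite + 'm::finite) \<Rightarrow> real^'d" where
  "proj y = (\<chi> i. y $ Inl i)"

definition proj_int :: "real^('d::finite + 'm::finite) \<Rightarrow> real^'m" where
  "proj_int y = (\<chi> j. y $ Inr j)"

definition int_lattice :: "(real^'n) set" where
  "int_lattice = {z. \<forall>i. z $ i \<in> \<int>}"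

definition full_rank_lattice :: "(real^'n) set \<Rightarrow> bool" where
  "full_rank_lattice L \<longleftrightarrow>
     (\<exists>B :: real^'n^'n. invertible B \<and> L = (\<lambda>z. z v* B) ` int_lattice)"

definition cut_project ::
  "(real^'m) set \<Rightarrow> (real^('d::finite + 'm::finite)) set \<Rightarrow> (real^'d) set" where
  "cut_project W L = proj ` {y \<in> L. proj_int y \<in> W}"

definition internal_closure :: "(real^('d::finite + 'm::finite)) set \<Rightarrow> (real^'m) set" where
  "internal_closure L = closure (proj_int ` L)"

text \<open>Lebesgue measure of dimension \<open>dim V\<close> on a linear subspace \<open>V\<close>, obtained from an orthonormal
  basis of \<open>V\<close> in the way \<open>lborel\<close> is obtained from \<open>Basis\<close>; it does not depend on the basis.\<close>

definition subspace_lborel :: "'a::euclidean_space set \<Rightarrow> 'a measure" where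
  "subspace_lborel V =
     (let B = (SOME B. B \<subseteq> V \<and> pairwise orthogonal B \<and> (\<forall>b\<in>B. norm b = 1) \<and> span B = V)
      in distr (\<Pi>\<^sub>M b\<in>B. (lborel :: real measure)) (restrict_space borel V)
           (\<lambda>c. \<Sum>b\<in>B. c b *\<^sub>R b))"

definition normalized_haar :: "'a::euclidean_space set \<Rightarrow> 'a measure" where
  "normalized_haar A0 = (THE \<nu>.
     space \<nu> = A0 \<and> sets \<nu> = sets (restrict_space borel A0) \<and>
     (\<forall>a\<in>A0. \<forall>E\<in>sets \<nu>. emeasure \<nu> ((+) a ` E) = emeasure \<nu> E) \<and>
     (let V = connected_component_set A0 0 in
        \<forall>E\<in>sets (restrict_space borel V). emeasure \<nu> E = emeasure (subspace_lborel V) E))"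

definition internal_measure ::
  "(real^('d::finite + 'm::finite)) set \<Rightarrow> real^('d + 'm) \<Rightarrow> (real^'m) measure" where
  "internal_measure L0 x =
     distr (normalized_haar (internal_closure L0))
       (restrict_space borel (internal_closure ((\<lambda>y. y + x) ` L0)))
       (\<lambda>y. y + proj_int x)"

text \<open>\<open>W\<close> is an admissible window for the affine lattice \<open>L0 + x\<close>, and the resulting
  cut-and-project set is regular.\<close>

definition admissible_window ::
  "(real^('d::finite + 'm::finite)) set \<Rightarrow> real^('d + 'm) \<Rightarrow> (real^'m) set \<Rightarrow> bool" where
  "admissible_window L0 x W \<longleftrightarrow>
     (let L = (\<lambda>y. y + x) ` L0; A = internal_closure L in
        bounded W \<and> W \<subseteq> A \<and> (top_of_set A) interior_of W \<noteq> {} \<and>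
        inj_on proj {y \<in> L. proj_int y \<in> W})"

definition regular_window ::
  "(real^('d::finite + 'm::finite)) set \<Rightarrow> real^('d + 'm) \<Rightarrow> (real^'m) set \<Rightarrow> bool" where
  "regular_window L0 x W \<longleftrightarrow>
     (top_of_set (internal_closure ((\<lambda>y. y + x) ` L0))) frontier_of W
       \<in> null_sets (internal_measure L0 x)"

section \<open>The affine special linear group and its homogeneous spaces\<close>

definition ASL :: "((real^'n^'n) \<times> (real^'n)) monoid" where
  "ASL = \<lparr>carrier = {(M, \<xi>). det M = 1},
          mult = (\<lambda>(M, \<xi>) (M', \<xi>'). (M ** M', \<xi> v* M' + \<xi>')),
          one = (mat 1, 0)\<rparr>"

lemma group_ASL: "group (ASL :: ((real^'n^'n) \<times> (real^'n)) monoid)"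
proof (rule groupI)
  fix x y z :: "(real^'n^'n) \<times> (real^'n)"
  show "x \<otimes>\<^bsub>ASL\<^esub> y \<otimes>\<^bsub>ASL\<^esub> z = x \<otimes>\<^bsub>ASL\<^esub> (y \<otimes>\<^bsub>ASL\<^esub> z)"
    by (cases x; cases y; cases z)
       (simp add: ASL_def matrix_mul_assoc vector_matrix_mul_assoc
          vector_matrix_left_distrib add.assoc)
next
  fix x :: "(real^'n^'n) \<times> (real^'n)"
  assume "x \<in> carrier ASL"
  then obtain M \<xi> where x: "x = (M, \<xi>)" and M: "det M = 1"
    by (auto simp: ASL_def)
  have "invertible M"
    using M by (simp add: invertible_det_nz)
  then obtain N where N: "M ** N = mat 1" "N ** M = mat 1"
    by (auto simp: invertible_def)
  have "det N = 1"
    using N(1) M by (metis det_I det_mul mult_1)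
  moreover have "(- (\<xi> v* N)) v* M + \<xi> = 0"
    using vector_matrix_mul_assoc[of \<xi> N M] N(2)
    by (metis add.left_inverse add.right_inverse add_eq_0_iff vector_matrix_left_distrib
        vector_matrix_mul_rid vector_matrix_mult_0)
  ultimately show "\<exists>y\<in>carrier ASL. y \<otimes>\<^bsub>ASL\<^esub> x = \<one>\<^bsub>ASL\<^esub>"
    using N x by (intro bexI[of _ "(N, - (\<xi> v* N))"]) (auto simp: ASL_def)
qed (auto simp: ASL_def det_mul det_I)

definition ASL_int :: "((real^'n^'n) \<times> (real^'n)) set" where
  "ASL_int = {(M, \<xi>). det M = 1 \<and> (\<forall>i j. M $ i $ j \<in> \<int>) \<and> (\<forall>i. \<xi> $ i \<in> \<int>)}"

definition SL_in_ASL :: "((real^'n^'n) \<times> (real^'n)) set" where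
  "SL_in_ASL = {(M, 0) |M. det M = 1}"

definition act :: "real^'n \<Rightarrow> (real^'n^'n) \<times> (real^'n) \<Rightarrow> real^'n" where
  "act y g = y v* fst g + snd g"

definition affine_grid :: "real \<Rightarrow> (real^'n^'n) \<times> (real^'n) \<Rightarrow> (real^'n) set" where
  "affine_grid \<delta> g = (\<lambda>z. (\<delta> powr (1 / real CARD('n))) *\<^sub>R act z g) ` int_lattice"

definition block_diag ::
  "real^'d^'d \<Rightarrow> real^('d::finite + 'm::finite)^('d + 'm)" where
  "block_diag A = (\<chi> i j. case (i, j) of
       (Inl a, Inl b) \<Rightarrow> A $ a $ b
     | (Inr a, Inr b) \<Rightarrow> (if a = b then 1 else 0)
     | _ \<Rightarrow> 0)"

definition phi ::
  "(real^('d::finite + 'm::finite)^('d + 'm)) \<times> (real^('d + 'm)) \<Rightarrow> real^'d^'d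
     \<Rightarrow> (real^('d + 'm)^('d + 'm)) \<times> (real^('d + 'm))" where
  "phi g A = g \<otimes>\<^bsub>ASL\<^esub> (block_diag A, 0) \<otimes>\<^bsub>ASL\<^esub> inv\<^bsub>ASL\<^esub> g"

text \<open>The set of cosets \<open>\<Lambda> h\<close> with \<open>h \<in> H\<close>, and the quotient topology it receives from \<open>H\<close>.
  For \<open>H\<close> the whole group this is the homogeneous space \<open>\<Lambda>\<setminus>G\<close>.\<close>

definition coset_set ::
  "((real^'n^'n) \<times> (real^'n)) set \<Rightarrow> ((real^'n^'n) \<times> (real^'n)) set
     \<Rightarrow> ((real^'n^'n) \<times> (real^'n)) set set" where
  "coset_set \<Lambda> H = (\<lambda>h. \<Lambda> #>\<^bsub>ASL\<^esub> h) ` H"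

definition coset_topology ::
  "((real^'n^'n) \<times> (real^'n)) set \<Rightarrow> ((real^'n^'n) \<times> (real^'n)) set
     \<Rightarrow> ((real^'n^'n) \<times> (real^'n)) set topology" where
  "coset_topology \<Lambda> H = topology (\<lambda>U. U \<subseteq> coset_set \<Lambda> H \<and>
     openin (top_of_set H) {h \<in> H. \<Lambda> #>\<^bsub>ASL\<^esub> h \<in> U})"

lemma openin_coset_topology:
  "openin (coset_topology \<Lambda> H) U \<longleftrightarrow>
     U \<subseteq> coset_set \<Lambda> H \<and> openin (top_of_set H) {h \<in> H. \<Lambda> #>\<^bsub>ASL\<^esub> h \<in> U}"
proof -
  have "istopology (\<lambda>U. U \<subseteq> coset_set \<Lambda> H \<and>
          openin (top_of_set H) {h \<in> H. \<Lambda> #>\<^bsub>ASL\<^esub> h \<in> U})"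
    unfolding istopology_def
  proof (intro conjI allI impI; (elim conjE)?)
    fix S T
    assume "openin (top_of_set H) {h \<in> H. \<Lambda> #>\<^bsub>ASL\<^esub> h \<in> S}"
      and "openin (top_of_set H) {h \<in> H. \<Lambda> #>\<^bsub>ASL\<^esub> h \<in> T}"
    then have "openin (top_of_set H)
        ({h \<in> H. \<Lambda> #>\<^bsub>ASL\<^esub> h \<in> S} \<inter> {h \<in> H. \<Lambda> #>\<^bsub>ASL\<^esub> h \<in> T})"
      by (rule openin_Int)
    moreover have "{h \<in> H. \<Lambda> #>\<^bsub>ASL\<^esub> h \<in> S} \<inter> {h \<in> H. \<Lambda> #>\<^bsub>ASL\<^esub> h \<in> T}
        = {h \<in> H. \<Lambda> #>\<^bsub>ASL\<^esub> h \<in> S \<inter> T}"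
      by auto
    ultimately show "openin (top_of_set H) {h \<in> H. \<Lambda> #>\<^bsub>ASL\<^esub> h \<in> S \<inter> T}"
      by simp
  next
    fix K
    assume "\<forall>U\<in>K. U \<subseteq> coset_set \<Lambda> H \<and>
      openin (top_of_set H) {h \<in> H. \<Lambda> #>\<^bsub>ASL\<^esub> h \<in> U}"
    then have "openin (top_of_set H) (\<Union>U\<in>K. {h \<in> H. \<Lambda> #>\<^bsub>ASL\<^esub> h \<in> U})"
      by blast
    moreover have "(\<Union>U\<in>K. {h \<in> H. \<Lambda> #>\<^bsub>ASL\<^esub> h \<in> U}) = {h \<in> H. \<Lambda> #>\<^bsub>ASL\<^esub> h \<in> \<Union>K}"
      by auto
    ultimately show "openin (top_of_set H) {h \<in> H. \<Lambda> #>\<^bsub>ASL\<^esub> h \<in> \<Union>K}"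
      by simp
  qed auto
  then show ?thesis
    by (simp add: coset_topology_def topology_inverse')
qed

text \<open>\<open>\<nu>\<close> is a probability measure on the Borel sets of a space \<open>T\<close> of cosets, invariant under
  right translation by \<open>H\<close>.\<close>

definition invariant_prob ::
  "((real^'n^'n) \<times> (real^'n)) set topology \<Rightarrow> ((real^'n^'n) \<times> (real^'n)) set
     \<Rightarrow> ((real^'n^'n) \<times> (real^'n)) set measure \<Rightarrow> bool" where
  "invariant_prob T H \<nu> \<longleftrightarrow>
     prob_space \<nu> \<and> space \<nu> = topspace T \<and>
     sets \<nu> = sigma_sets (topspace T) {U. openin T U} \<and>
     (\<forall>h\<in>H. \<forall>E\<in>sets \<nu>. emeasure \<nu> ((\<lambda>x. x #>\<^bsub>ASL\<^esub> h) ` E) = emeasure \<nu> E)"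

definition is_lattice_in ::
  "((real^'n^'n) \<times> (real^'n)) set \<Rightarrow> ((real^'n^'n) \<times> (real^'n)) set \<Rightarrow> bool" where
  "is_lattice_in \<Lambda> H \<longleftrightarrow>
     subgroup \<Lambda> ASL \<and> \<Lambda> \<subseteq> H \<and> discrete \<Lambda> \<and>
     (\<exists>\<nu>. invariant_prob (coset_topology \<Lambda> H) H \<nu>)"

text \<open>\<open>H\<close> is the group \<open>H\<^sub>g\<close> attached to \<open>g\<close> by Ratner's theorems; at most one \<open>H\<close> satisfies this.\<close>

definition ratner_group ::
  "(real^('d::finite + 'm::finite)^('d + 'm)) \<times> (real^('d + 'm))
     \<Rightarrow> ((real^('d + 'm)^('d + 'm)) \<times> (real^('d + 'm))) set \<Rightarrow> bool" where
  "ratner_group g H \<longleftrightarrow>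
     subgroup H ASL \<and> closedin (top_of_set (carrier ASL)) H \<and> connected H \<and>
     is_lattice_in (ASL_int \<inter> H) H \<and>
     phi g ` {A :: real^'d^'d. det A = 1} \<subseteq> H \<and>
     coset_topology ASL_int (carrier ASL) closure_of
         coset_set ASL_int (phi g ` {A :: real^'d^'d. det A = 1})
       = coset_set ASL_int H"

text \<open>\<open>\<mu>\<close> is the right \<open>H\<close>-invariant probability measure on \<open>X = \<Gamma>\<setminus>\<Gamma>H\<close>, which carries the topology
  inherited from \<open>\<Gamma>\<setminus>G\<close>.\<close>

definition is_ratner_measure ::
  "((real^'n^'n) \<times> (real^'n)) set \<Rightarrow> ((real^'n^'n) \<times> (real^'n)) set measure \<Rightarrow> bool" where
  "is_ratner_measure H \<mu> \<longleftrightarrow>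
     invariant_prob
       (subtopology (coset_topology ASL_int (carrier ASL)) (coset_set ASL_int H)) H \<mu>"

section \<open>The constant attached to the visible points\<close>

definition cone :: "real \<Rightarrow> real \<Rightarrow> (real^2) set" where
  "cone \<theta> \<sigma> = {x. 0 < x $ 1 \<and> x $ 1 < 1 \<and> \<bar>x $ 2\<bar> < \<sigma> / \<theta> * x $ 1}"

text \<open>The set \<open>P\<^sup>x\<close> does not depend on the representative \<open>h \<in> H\<close> of \<open>x\<close>, because \<open>ASL_int\<close>
  preserves \<open>int_lattice\<close>. The supremum is taken in the extended reals, so that it is meaningful
  without knowing beforehand that the set is bounded.\<close>

definition m_visible ::
  "(real^'m) set \<Rightarrow> real \<Rightarrow> (real^(2 + 'm::finite)^(2 + 'm)) \<times> (real^(2 + 'm))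
     \<Rightarrow> ((real^(2 + 'm)^(2 + 'm)) \<times> (real^(2 + 'm))) set
     \<Rightarrow> ((real^(2 + 'm)^(2 + 'm)) \<times> (real^(2 + 'm))) set measure \<Rightarrow> ereal" where
  "m_visible W \<delta> g H \<mu> =
     (let P = cut_project W (affine_grid \<delta> g) in
      Sup {ereal \<sigma> |\<sigma>. 0 \<le> \<sigma> \<and>
        (AE x in \<mu>. \<forall>h\<in>H. x = ASL_int #>\<^bsub>ASL\<^esub> h \<longrightarrow>
           (let V = visible (cut_project W (affine_grid \<delta> (h \<otimes>\<^bsub>ASL\<^esub> g)))
                      \<inter> cone (density_of P) (inverse (kappa P) * \<sigma>)
            in finite V \<and> card V \<le> 1))})"

end

theory Submission
  imports Defs "HOL-Real_Asymp.Real_Asymp"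
begin

text \<open>
  That the grid of \<open>hg\<close> contains two points over the window's interior whose projections lie in the
  cone and are not parallel is an open condition on \<open>h\<close>, invariant under \<open>ASL_int\<close> and satisfied by
  some \<open>h\<close> in \<open>SL(n)\<close>. As the cone is star-shaped about the origin, the two rays then carry two
  visible points in the cone, and nonempty open subsets of the homogeneous space are not null.

  For the cone to be nonempty both densities have to be positive. Density of the orbit forces the
  internal projection of the grid to be dense, so the cut-and-project set \<open>P\<close> is relatively dense.
  For the visible points, cut the disc of radius \<open>T\<close> into \<open>K\<close> annuli: in each annulus, all
  points of \<open>P\<close> but one per ray are injectively encoded by their differences from that one. These
  are elements of \<open>P - P\<close> of length at most \<open>T/K\<close>, of which there are \<open>O(T\<^sup>2/K\<^sup>2)\<close>. If \<open>v\<close> is the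
  number of visible points in the disc, then \<open>P\<close> has at most \<open>(K + 1) (v + O(T\<^sup>2/K\<^sup>2))\<close> points there;
  for large \<open>K\<close> this rules out \<open>v = o(T\<^sup>2)\<close>.
\<close>

subsection \<open>Open subsets of the homogeneous space\<close>

lemma ASL_mult: "a \<otimes>\<^bsub>ASL\<^esub> b = (fst a ** fst b, snd a v* fst b + snd b)"
  by (simp add: ASL_def split_beta)

lemma ASL_carrier: "a \<in> carrier ASL \<longleftrightarrow> det (fst a) = 1"
  by (auto simp: ASL_def split_beta)

lemma act_mult: "act z (a \<otimes>\<^bsub>ASL\<^esub> b) = act (act z a) b"
  by (simp add: act_def ASL_mult vector_matrix_mul_assoc vector_matrix_left_distrib add.assoc)

lemma ASL_int_subset: "ASL_int \<subseteq> carrier ASL"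
  by (auto simp: ASL_int_def ASL_def)

lemma one_in_ASL_int: "\<one>\<^bsub>ASL\<^esub> \<in> (ASL_int :: ((real^'n^'n) \<times> (real^'n)) set)"
proof -
  have "\<forall>i j. (mat 1 :: real^'n^'n) $ i $ j \<in> \<int>"
    by (simp add: mat_def)
  then show ?thesis
    by (simp add: ASL_int_def ASL_def)
qed

lemma act_int_lattice:
  assumes "z \<in> int_lattice" "\<gamma> \<in> ASL_int"
  shows "act z \<gamma> \<in> int_lattice"
  using assms
  by (auto simp: int_lattice_def ASL_int_def act_def vector_matrix_mult_def
      intro!: Ints_add Ints_mult Ints_sum)

lemma continuous_on_vector_matrix [continuous_intros]:
  fixes f :: "'a::topological_space \<Rightarrow> real^'n" and A :: "'a \<Rightarrow> real^'k^'n"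
  assumes "continuous_on S f" "continuous_on S A"
  shows "continuous_on S (\<lambda>x. f x v* A x)"
  unfolding vector_matrix_mult_def using assms by (intro continuous_intros)

lemma continuous_on_matrix_matrix [continuous_intros]:
  fixes A :: "'a::topological_space \<Rightarrow> real^'n^'k" and B :: "'a \<Rightarrow> real^'l^'n"
  assumes "continuous_on S A" "continuous_on S B"
  shows "continuous_on S (\<lambda>x. A x ** B x)"
  unfolding matrix_matrix_mult_def using assms by (intro continuous_intros)

lemma continuous_on_act: "continuous_on S (\<lambda>h. act z (h \<otimes>\<^bsub>ASL\<^esub> g))"
  unfolding act_def ASL_mult fst_conv snd_conv by (intro continuous_intros)

lemma continuous_on_ASL_mult_left: "continuous_on S (\<lambda>k. h \<otimes>\<^bsub>ASL\<^esub> k)"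
  unfolding ASL_mult by (intro continuous_intros)

lemma continuous_on_ASL_mult_right: "continuous_on S (\<lambda>k. k \<otimes>\<^bsub>ASL\<^esub> h)"
  unfolding ASL_mult by (intro continuous_intros)

text \<open>Within the group this is saturation under left multiplication by \<open>ASL_int\<close>,
  which characterises the preimages of sets of cosets. One direction says it all because
  \<open>ASL_int\<close> contains the inverses of its elements.\<close>

definition int_invariant :: "((real^'n^'n) \<times> (real^'n)) set \<Rightarrow> bool" where
  "int_invariant U \<longleftrightarrow> (\<forall>\<gamma>\<in>ASL_int. \<forall>u\<in>carrier ASL. \<gamma> \<otimes>\<^bsub>ASL\<^esub> u \<in> U \<longrightarrow> u \<in> U)"

text \<open>If the cosets of \<open>h\<close> and of some \<open>u\<close> in \<open>U\<close>
  agree, then \<open>u\<close> is \<gamma> times \<open>h\<close> with \<gamma> in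
  \<open>ASL_int\<close>, and saturation passes membership from \<open>u\<close> to
  \<open>h\<close>.\<close>

lemma coset_in_coset_set_iff:
  assumes "U \<subseteq> carrier ASL" "int_invariant U" "h \<in> carrier ASL"
  shows "ASL_int #>\<^bsub>ASL\<^esub> h \<in> coset_set ASL_int U \<longleftrightarrow> h \<in> U"
proof
  assume "ASL_int #>\<^bsub>ASL\<^esub> h \<in> coset_set ASL_int U"
  then obtain u where u: "u \<in> U" "ASL_int #>\<^bsub>ASL\<^esub> h = ASL_int #>\<^bsub>ASL\<^esub> u"
    by (auto simp: coset_set_def)
  have "\<one>\<^bsub>ASL\<^esub> \<otimes>\<^bsub>ASL\<^esub> u \<in> ASL_int #>\<^bsub>ASL\<^esub> u"
    using one_in_ASL_int by (auto simp: r_coset_def)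
  then have "u \<in> ASL_int #>\<^bsub>ASL\<^esub> h"
    using u monoid.l_one[OF group.is_monoid[OF group_ASL]] assms(1) by (metis subsetD)
  then show "h \<in> U"
    using u(1) assms(2,3) by (auto simp: r_coset_def int_invariant_def)
qed (auto simp: coset_set_def)

text \<open>By saturation, pulling the image of \<open>U\<close> in the quotient back to the group
  returns \<open>U\<close> itself.\<close>

lemma openin_coset_set:
  assumes "openin (top_of_set (carrier ASL)) U" "int_invariant U"
  shows "openin (coset_topology ASL_int (carrier ASL)) (coset_set ASL_int U)"
proof -
  have U: "U \<subseteq> carrier ASL"
    using assms(1) openin_imp_subset by blast
  have "{h \<in> carrier ASL. ASL_int #>\<^bsub>ASL\<^esub> h \<in> coset_set ASL_int U} = U"
    using coset_in_coset_set_iff[OF U assms(2)] U by auto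
  with assms(1) U show ?thesis
    by (auto simp: openin_coset_topology coset_set_def)
qed

lemma topspace_coset_topology:
  "topspace (coset_topology ASL_int (carrier ASL)) = coset_set ASL_int (carrier ASL)"
proof (rule antisym)
  show "topspace (coset_topology ASL_int (carrier ASL)) \<subseteq> coset_set ASL_int (carrier ASL)"
    using openin_topspace openin_coset_topology by blast
  have "int_invariant (carrier ASL)"
    by (simp add: int_invariant_def)
  then show "coset_set ASL_int (carrier ASL) \<subseteq> topspace (coset_topology ASL_int (carrier ASL))"
    by (intro openin_subset openin_coset_set) auto
qed

lemma int_invariantI:
  assumes "\<And>\<gamma> u. \<lbrakk>\<gamma> \<in> ASL_int; u \<in> carrier ASL; Q (\<gamma> \<otimes>\<^bsub>ASL\<^esub> u)\<rbrakk> \<Longrightarrow> Q u"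
  shows "int_invariant {u \<in> carrier ASL. Q u}"
  using assms unfolding int_invariant_def by blast

lemma coset_translate:
  assumes "u \<in> carrier ASL" "h \<in> carrier ASL"
  shows "(ASL_int #>\<^bsub>ASL\<^esub> u) #>\<^bsub>ASL\<^esub> h = ASL_int #>\<^bsub>ASL\<^esub> (u \<otimes>\<^bsub>ASL\<^esub> h)"
  using group.coset_mult_assoc[OF group_ASL ASL_int_subset assms] .

text \<open>By invariance, all right translates of a null set by \<open>H\<close> are null. The
  translates of this open set by the inverses of a countable dense subset of \<open>H\<close>
  already cover the space, which has mass 1.\<close>

lemma invariant_prob_open_not_null:
  fixes H :: "((real^'n^'n) \<times> (real^'n)) set"
  assumes inv: "invariant_prob (subtopology (coset_topology ASL_int (carrier ASL)) (coset_set ASL_int H)) H \<nu>"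
    and H: "subgroup H ASL"
    and U: "openin (top_of_set (carrier ASL)) U" "int_invariant U" "U \<inter> H \<noteq> {}"
  shows "coset_set ASL_int U \<inter> coset_set ASL_int H \<notin> null_sets \<nu>"
proof
  let ?X = "coset_set ASL_int H"
  let ?E = "coset_set ASL_int U \<inter> ?X"
  assume null: "?E \<in> null_sets \<nu>"
  interpret G: group "ASL :: ((real^'n^'n) \<times> (real^'n)) monoid"
    by (rule group_ASL)
  have Hc: "H \<subseteq> carrier ASL"
    using H by (rule subgroup.subset)
  have Uc: "U \<subseteq> carrier ASL"
    using U(1) openin_imp_subset by blast
  have sp: "space \<nu> = ?X"
    using inv Hc unfolding invariant_prob_def
    by (auto simp: topspace_coset_topology coset_set_def)
  obtain D where D: "countable D" "D \<subseteq> H" "H \<subseteq> closure D"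
    using separable[of H] by blast
  have translate: "(\<lambda>x. x #>\<^bsub>ASL\<^esub> h) ` ?E \<in> null_sets \<nu>" if h: "h \<in> H" for h
  proof -
    have hc: "h \<in> carrier ASL" "inv\<^bsub>ASL\<^esub> h \<in> H" "inv\<^bsub>ASL\<^esub> h \<in> carrier ASL"
      using h Hc subgroup.m_inv_closed[OF H h] by auto
    \<comment> \<open>This is the translate of \<open>U\<close> by \<open>h\<close>. It shows that
      the translate of \<open>?E\<close> is measurable, which has to be known separately:
      \<open>emeasure\<close> is 0 on non-measurable sets as well.\<close>
    define U' where "U' = {k \<in> carrier ASL. k \<otimes>\<^bsub>ASL\<^esub> inv\<^bsub>ASL\<^esub> h \<in> U}"
    have "openin (top_of_set (carrier ASL)) (carrier ASL \<inter> (\<lambda>k. k \<otimes>\<^bsub>ASL\<^esub> inv\<^bsub>ASL\<^esub> h) -` U)"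
      using U(1) hc by (intro continuous_openin_preimage continuous_on_ASL_mult_right) auto
    moreover have "carrier ASL \<inter> (\<lambda>k. k \<otimes>\<^bsub>ASL\<^esub> inv\<^bsub>ASL\<^esub> h) -` U = U'"
      by (auto simp: U'_def)
    ultimately have "openin (top_of_set (carrier ASL)) U'"
      by simp
    moreover have "int_invariant U'"
      unfolding U'_def
    proof (rule int_invariantI)
      fix \<gamma> u :: "(real^'n^'n) \<times> (real^'n)"
      assume a: "\<gamma> \<in> ASL_int" "u \<in> carrier ASL" "\<gamma> \<otimes>\<^bsub>ASL\<^esub> u \<otimes>\<^bsub>ASL\<^esub> inv\<^bsub>ASL\<^esub> h \<in> U"
      then have "\<gamma> \<otimes>\<^bsub>ASL\<^esub> (u \<otimes>\<^bsub>ASL\<^esub> inv\<^bsub>ASL\<^esub> h) \<in> U"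
        using G.m_assoc[OF subsetD[OF ASL_int_subset a(1)] a(2) hc(3)] by simp
      with a U(2) hc(3) show "u \<otimes>\<^bsub>ASL\<^esub> inv\<^bsub>ASL\<^esub> h \<in> U"
        unfolding int_invariant_def by blast
    qed
    ultimately have "openin (coset_topology ASL_int (carrier ASL)) (coset_set ASL_int U')"
      by (rule openin_coset_set)
    then have "openin (subtopology (coset_topology ASL_int (carrier ASL)) ?X)
        (coset_set ASL_int U' \<inter> ?X)"
      by (rule openin_subtopology_Int)
    then have "coset_set ASL_int U' \<inter> ?X \<in> sets \<nu>"
      using inv unfolding invariant_prob_def by simp
    moreover have "(\<lambda>x. x #>\<^bsub>ASL\<^esub> h) ` ?E = coset_set ASL_int U' \<inter> ?X"
    proof (intro subset_antisym subsetI)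
      fix y assume "y \<in> (\<lambda>x. x #>\<^bsub>ASL\<^esub> h) ` ?E"
      then obtain k where k: "k \<in> H" "ASL_int #>\<^bsub>ASL\<^esub> k \<in> coset_set ASL_int U"
          "y = (ASL_int #>\<^bsub>ASL\<^esub> k) #>\<^bsub>ASL\<^esub> h"
        unfolding coset_set_def[of ASL_int H] by blast
      have kc: "k \<in> carrier ASL"
        using k(1) Hc by blast
      have "k \<in> U"
        using k(2) coset_in_coset_set_iff[OF Uc U(2) kc] by simp
      then have "k \<otimes>\<^bsub>ASL\<^esub> h \<in> U'" and "k \<otimes>\<^bsub>ASL\<^esub> h \<in> H"
        using kc hc h k(1) subgroup.m_closed[OF H] by (simp_all add: U'_def G.m_assoc)
      then show "y \<in> coset_set ASL_int U' \<inter> ?X"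
        unfolding k(3) coset_translate[OF kc hc(1)] by (auto simp: coset_set_def)
    next
      fix y assume y: "y \<in> coset_set ASL_int U' \<inter> ?X"
      then obtain k where k: "k \<in> H" "y = ASL_int #>\<^bsub>ASL\<^esub> k"
        by (auto simp: coset_set_def)
      have kc: "k \<in> carrier ASL"
        using k Hc by auto
      have "k \<in> U'"
        using y k kc coset_in_coset_set_iff[OF _ \<open>int_invariant U'\<close> kc] by (auto simp: U'_def)
      then have "ASL_int #>\<^bsub>ASL\<^esub> (k \<otimes>\<^bsub>ASL\<^esub> inv\<^bsub>ASL\<^esub> h) \<in> ?E"
        using k hc subgroup.m_closed[OF H] by (auto simp: U'_def coset_set_def)
      moreover have "y = (ASL_int #>\<^bsub>ASL\<^esub> (k \<otimes>\<^bsub>ASL\<^esub> inv\<^bsub>ASL\<^esub> h)) #>\<^bsub>ASL\<^esub> h"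
        using kc hc by (simp add: coset_translate G.m_assoc k(2))
      ultimately show "y \<in> (\<lambda>x. x #>\<^bsub>ASL\<^esub> h) ` ?E"
        by blast
    qed
    moreover have "emeasure \<nu> ((\<lambda>x. x #>\<^bsub>ASL\<^esub> h) ` ?E) = emeasure \<nu> ?E"
      using inv h null_setsD2[OF null] unfolding invariant_prob_def by blast
    then have "emeasure \<nu> ((\<lambda>x. x #>\<^bsub>ASL\<^esub> h) ` ?E) = 0"
      using null_setsD1[OF null] by simp
    ultimately show ?thesis
      by auto
  qed
  have "space \<nu> \<subseteq> (\<Union>k\<in>D. (\<lambda>x. x #>\<^bsub>ASL\<^esub> inv\<^bsub>ASL\<^esub> k) ` ?E)"
  proof
    fix y assume "y \<in> space \<nu>"
    then obtain h where h: "h \<in> H" "y = ASL_int #>\<^bsub>ASL\<^esub> h"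
      by (auto simp: sp coset_set_def)
    obtain u where u: "u \<in> U" "u \<in> H"
      using U(3) by auto
    have hc: "h \<in> carrier ASL"
      using h Hc by auto
    \<comment> \<open>The \<open>k\<close> that carry \<open>h\<close> into \<open>U\<close> form a
      relatively open set. It contains the point \<open>k0\<close> of \<open>H\<close>, hence also a
      point of \<open>D\<close>.\<close>
    define k0 where "k0 = inv\<^bsub>ASL\<^esub> h \<otimes>\<^bsub>ASL\<^esub> u"
    have k0: "k0 \<in> H" "h \<otimes>\<^bsub>ASL\<^esub> k0 = u"
      using h u hc Uc subgroup.m_closed[OF H] subgroup.m_inv_closed[OF H]
      by (simp_all add: k0_def subsetD G.m_assoc[symmetric])
    have "openin (top_of_set (carrier ASL)) (carrier ASL \<inter> (\<lambda>k. h \<otimes>\<^bsub>ASL\<^esub> k) -` U)"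
      using U(1) hc by (intro continuous_openin_preimage continuous_on_ASL_mult_left) auto
    then obtain O' where O': "open O'" "carrier ASL \<inter> (\<lambda>k. h \<otimes>\<^bsub>ASL\<^esub> k) -` U = carrier ASL \<inter> O'"
      by (auto simp: openin_open)
    have "k0 \<in> O'"
      using O'(2) k0 u Hc by auto
    then obtain k where k: "k \<in> D" "k \<in> O'"
      using D(3) k0(1) O'(1) by (meson closure_iff_nhds_not_empty disjoint_iff in_mono subset_refl)
    have kH: "k \<in> H" "k \<in> carrier ASL" "inv\<^bsub>ASL\<^esub> k \<in> carrier ASL"
      using k D(2) Hc by auto
    have "h \<otimes>\<^bsub>ASL\<^esub> k \<in> U" "h \<otimes>\<^bsub>ASL\<^esub> k \<in> H"
      using O'(2) k kH h subgroup.m_closed[OF H] by auto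
    then have "ASL_int #>\<^bsub>ASL\<^esub> (h \<otimes>\<^bsub>ASL\<^esub> k) \<in> ?E"
      by (auto simp: coset_set_def)
    moreover have "y = (ASL_int #>\<^bsub>ASL\<^esub> (h \<otimes>\<^bsub>ASL\<^esub> k)) #>\<^bsub>ASL\<^esub> inv\<^bsub>ASL\<^esub> k"
      using kH hc by (simp add: coset_translate G.m_assoc h(2))
    ultimately show "y \<in> (\<Union>k\<in>D. (\<lambda>x. x #>\<^bsub>ASL\<^esub> inv\<^bsub>ASL\<^esub> k) ` ?E)"
      using k(1) by blast
  qed
  moreover have "(\<Union>k\<in>D. (\<lambda>x. x #>\<^bsub>ASL\<^esub> inv\<^bsub>ASL\<^esub> k) ` ?E) \<in> null_sets \<nu>"
    using D H by (intro null_sets_UN' translate) (auto intro: subgroup.m_inv_closed)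
  ultimately have "emeasure \<nu> (space \<nu>) = 0"
    by (meson null_sets_subset null_setsD1 sets.top)
  then show False
    using inv prob_space.emeasure_space_1 unfolding invariant_prob_def by fastforce
qed

subsection \<open>Lattices\<close>

lemma norm_proj_proj_int: "(norm y)\<^sup>2 = (norm (proj y))\<^sup>2 + (norm (proj_int y))\<^sup>2"
  for y :: "real^('d::finite + 'm::finite)"
proof -
  have "(\<Sum>i\<in>UNIV. (y $ i)\<^sup>2) = (\<Sum>i\<in>UNIV. (y $ Inl i)\<^sup>2) + (\<Sum>j\<in>UNIV. (y $ Inr j)\<^sup>2)"
    unfolding UNIV_Plus_UNIV[symmetric] by (subst sum.Plus) (auto simp: o_def)
  then show ?thesis
    by (simp add: norm_vec_def L2_set_def proj_def proj_int_def sum_nonneg)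
qed

lemma norm_proj_le: "norm (proj y) \<le> norm y" and norm_proj_int_le: "norm (proj_int y) \<le> norm y"
  by (rule power2_le_imp_le; simp add: norm_proj_proj_int[of y])+

lemma norm_le_proj_proj_int: "norm y \<le> norm (proj y) + norm (proj_int y)"
  by (rule power2_le_imp_le) (simp_all add: norm_proj_proj_int[of y] power2_sum)

lemma proj_add: "proj (y + z) = proj y + proj z"
  and proj_diff: "proj (y - z) = proj y - proj z"
  and proj_int_add: "proj_int (y + z) = proj_int y + proj_int z"
  and proj_int_diff: "proj_int (y - z) = proj_int y - proj_int z"
  by (simp_all add: proj_def proj_int_def vec_eq_iff)

lemma continuous_on_proj [continuous_intros]:
  "continuous_on S f \<Longrightarrow> continuous_on S (\<lambda>x. proj (f x))"
  unfolding proj_def by (intro continuous_intros)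

lemma continuous_on_proj_int [continuous_intros]:
  "continuous_on S f \<Longrightarrow> continuous_on S (\<lambda>x. proj_int (f x))"
  unfolding proj_int_def by (intro continuous_intros)

section \<open>Finiteness of grids in bounded sets\<close>

lemma finite_int_lattice_bounded:
  assumes "bounded S"
  shows "finite (int_lattice \<inter> S :: (real^'n) set)"
proof -
  obtain B where B: "\<And>z. z \<in> S \<Longrightarrow> norm z \<le> B"
    using assms by (auto simp: bounded_iff)
  have "finite ((\<lambda>f. \<chi> i. real_of_int (f i)) ` (PiE (UNIV :: 'n set) (\<lambda>_. {-\<lceil>B\<rceil>..\<lceil>B\<rceil>})))"
    by (intro finite_imageI finite_PiE) auto
  moreover have "int_lattice \<inter> S \<subseteq> (\<lambda>f. \<chi> i. real_of_int (f i)) ` (PiE (UNIV :: 'n set) (\<lambda>_. {-\<lceil>B\<rceil>..\<lceil>B\<rceil>}))"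
  proof
    fix z :: "real^'n" assume z: "z \<in> int_lattice \<inter> S"
    have "\<bar>z $ i\<bar> \<le> B" for i
      using B[of z] z component_le_norm_cart[of z i] by auto
    then have "-\<lceil>B\<rceil> \<le> \<lfloor>z $ i\<rfloor> \<and> \<lfloor>z $ i\<rfloor> \<le> \<lceil>B\<rceil>" for i
      by (smt (verit) ceiling_correct floor_correct of_int_less_iff of_int_minus)
    then have "(\<lambda>i. \<lfloor>z $ i\<rfloor>) \<in> PiE (UNIV :: 'n set) (\<lambda>_. {-\<lceil>B\<rceil>..\<lceil>B\<rceil>})"
      by auto
    moreover have "z = (\<chi> i. real_of_int \<lfloor>z $ i\<rfloor>)"
      using z by (auto simp: int_lattice_def vec_eq_iff elim!: Ints_cases)
    ultimately show "z \<in> (\<lambda>f. \<chi> i. real_of_int (f i)) ` (PiE (UNIV :: 'n set) (\<lambda>_. {-\<lceil>B\<rceil>..\<lceil>B\<rceil>}))"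
      by (intro image_eqI[where x = "\<lambda>i. \<lfloor>z $ i\<rfloor>"])
  qed
  ultimately show ?thesis
    by (rule finite_subset[rotated])
qed

text \<open>The linear lattice of which \<open>affine_grid \<delta> g\<close> is a translate: in a
  difference of two grid points the translation part of \<open>g\<close> cancels.\<close>

definition grid_differences :: "real \<Rightarrow> (real^'n^'n) \<times> (real^'n) \<Rightarrow> (real^'n) set" where
  "grid_differences \<delta> g = (\<lambda>z. (\<delta> powr (1 / real CARD('n))) *\<^sub>R (z v* fst g)) ` int_lattice"

lemma int_lattice_add: "y \<in> int_lattice \<Longrightarrow> z \<in> int_lattice \<Longrightarrow> y + z \<in> int_lattice"
  and int_lattice_diff: "y \<in> int_lattice \<Longrightarrow> z \<in> int_lattice \<Longrightarrow> y - z \<in> int_lattice"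
  by (auto simp: int_lattice_def)

lemma vector_matrix_diff_distrib:
  fixes A :: "real^'k^'n" shows "(y - z) v* A = y v* A - z v* A"
  by (simp add: vector_matrix_mult_def vec_eq_iff algebra_simps sum_subtractf)

lemma affine_grid_diff:
  fixes g :: "(real^'n^'n) \<times> (real^'n)"
  assumes "y \<in> affine_grid \<delta> g" "z \<in> affine_grid \<delta> g"
  shows "y - z \<in> grid_differences \<delta> g"
proof -
  obtain a b where "a \<in> int_lattice" "b \<in> int_lattice"
      "y = (\<delta> powr (1 / real CARD('n))) *\<^sub>R act a g" "z = (\<delta> powr (1 / real CARD('n))) *\<^sub>R act b g"
    using assms unfolding affine_grid_def by blast
  moreover from this have "y - z = (\<delta> powr (1 / real CARD('n))) *\<^sub>R ((a - b) v* fst g)"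
    by (simp add: act_def vector_matrix_diff_distrib scaleR_diff_right scaleR_add_right)
  ultimately show ?thesis
    unfolding grid_differences_def using int_lattice_diff by blast
qed

lemma grid_differences_diff:
  fixes g :: "(real^'n^'n) \<times> (real^'n)"
  assumes "y \<in> grid_differences \<delta> g" "z \<in> grid_differences \<delta> g"
  shows "y - z \<in> grid_differences \<delta> g"
proof -
  obtain a b where "a \<in> int_lattice" "b \<in> int_lattice"
      "y = (\<delta> powr (1 / real CARD('n))) *\<^sub>R (a v* fst g)"
      "z = (\<delta> powr (1 / real CARD('n))) *\<^sub>R (b v* fst g)"
    using assms unfolding grid_differences_def by blast
  moreover from this have "y - z = (\<delta> powr (1 / real CARD('n))) *\<^sub>R ((a - b) v* fst g)"
    by (simp add: vector_matrix_diff_distrib scaleR_diff_right)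
  ultimately show ?thesis
    unfolding grid_differences_def using int_lattice_diff by blast
qed

lemma affine_grid_add:
  fixes g :: "(real^'n^'n) \<times> (real^'n)"
  assumes "y \<in> affine_grid \<delta> g" "z \<in> grid_differences \<delta> g"
  shows "y + z \<in> affine_grid \<delta> g"
proof -
  obtain a b where "a \<in> int_lattice" "b \<in> int_lattice"
      "y = (\<delta> powr (1 / real CARD('n))) *\<^sub>R act a g"
      "z = (\<delta> powr (1 / real CARD('n))) *\<^sub>R (b v* fst g)"
    using assms unfolding grid_differences_def affine_grid_def by blast
  moreover from this have "y + z = (\<delta> powr (1 / real CARD('n))) *\<^sub>R act (a + b) g"
    by (simp add: act_def vector_matrix_left_distrib scaleR_add_right)
  ultimately show ?thesis
    unfolding affine_grid_def using int_lattice_add by blast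
qed

text \<open>An injective linear map is bounded below, so the integer vectors whose images lie in a
  bounded set are themselves bounded.\<close>

lemma finite_grid_differences_bounded:
  fixes g :: "(real^'n^'n) \<times> (real^'n)"
  assumes g: "g \<in> carrier ASL" and "\<delta> > 0" and "bounded S"
  shows "finite (grid_differences \<delta> g \<inter> S)"
proof -
  let ?f = "\<lambda>z. (\<delta> powr (1 / real CARD('n))) *\<^sub>R (z v* fst g)"
  have lin: "linear ?f"
  proof (rule linearI)
    show "?f (b *\<^sub>R z) = b *\<^sub>R ?f z" for b z
      by (simp add: vector_matrix_mult_def vec_eq_iff sum_distrib_left mult_ac)
  qed (simp only: vector_matrix_left_distrib scaleR_add_right)
  have "invertible (fst g)"
    using g by (simp add: ASL_def invertible_det_nz split_beta)
  then obtain N where N: "fst g ** N = mat 1"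
    by (auto simp: invertible_def)
  have "inj ?f"
  proof (rule injI)
    fix y z assume "?f y = ?f z"
    then have "y v* fst g v* N = z v* fst g v* N"
      using \<open>\<delta> > 0\<close> by simp
    then show "y = z"
      by (simp add: vector_matrix_mul_assoc N)
  qed
  then obtain B where B: "B > 0" "\<And>z. B * norm z \<le> norm (?f z)"
    using linear_inj_bounded_below_pos[OF lin] by blast
  obtain R where R: "\<And>y. y \<in> S \<Longrightarrow> norm y \<le> R"
    using \<open>bounded S\<close> by (auto simp: bounded_iff)
  have "norm z \<le> R / B" if "?f z \<in> S" for z
    using B(2)[of z] R[OF that] B(1) by (simp add: field_simps)
  then have "grid_differences \<delta> g \<inter> S \<subseteq> ?f ` (int_lattice \<inter> cball 0 (R / B))"
    unfolding grid_differences_def by auto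
  then show ?thesis
    by (meson bounded_cball finite_imageI finite_int_lattice_bounded finite_subset)
qed

lemma affine_grid_nonempty: "\<exists>y. y \<in> affine_grid \<delta> g"
  unfolding affine_grid_def int_lattice_def by (auto intro!: exI[of _ 0])

lemma finite_affine_grid_bounded:
  assumes "g \<in> carrier ASL" "\<delta> > 0" "bounded S"
  shows "finite (affine_grid \<delta> g \<inter> S)"
proof -
  obtain y0 where y0: "y0 \<in> affine_grid \<delta> g"
    using affine_grid_nonempty by blast
  have "finite (grid_differences \<delta> g \<inter> (\<lambda>y. y - y0) ` S)"
    using assms by (intro finite_grid_differences_bounded bounded_translation_minus)
  then have "finite ((\<lambda>y. y + y0) ` (grid_differences \<delta> g \<inter> (\<lambda>y. y - y0) ` S))"
    by simp
  moreover have "affine_grid \<delta> g \<inter> S \<subseteq> (\<lambda>y. y + y0) ` (grid_differences \<delta> g \<inter> (\<lambda>y. y - y0) ` S)"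
  proof
    fix y assume "y \<in> affine_grid \<delta> g \<inter> S"
    then show "y \<in> (\<lambda>y. y + y0) ` (grid_differences \<delta> g \<inter> (\<lambda>y. y - y0) ` S)"
      using affine_grid_diff[OF _ y0] by (intro image_eqI[of _ _ "y - y0"]) auto
  qed
  ultimately show ?thesis
    by (rule finite_subset[rotated])
qed

lemma finite_cut_project_bounded:
  assumes "g \<in> carrier ASL" "\<delta> > 0" "bounded W" "bounded S"
  shows "finite (cut_project W (affine_grid \<delta> g) \<inter> S)"
proof -
  obtain a b where ab: "\<And>w. w \<in> W \<Longrightarrow> norm w \<le> a" "\<And>p. p \<in> S \<Longrightarrow> norm p \<le> b"
    using assms(3,4) by (auto simp: bounded_iff)
  have "norm y \<le> b + a" if "proj_int y \<in> W" "proj y \<in> S" for y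
    using ab(1)[OF that(1)] ab(2)[OF that(2)] norm_le_proj_proj_int[of y] by linarith
  then have "cut_project W (affine_grid \<delta> g) \<inter> S \<subseteq> proj ` (affine_grid \<delta> g \<inter> cball 0 (b + a))"
    unfolding cut_project_def by auto
  then show ?thesis
    using finite_affine_grid_bounded[OF assms(1,2) bounded_cball] finite_subset by blast
qed

lemma card_le_mult_fibres:
  assumes "finite S" "\<And>y. y \<in> f ` S \<Longrightarrow> card {x \<in> S. f x = y} \<le> C"
  shows "card S \<le> card (f ` S) * C"
proof -
  have "card S = (\<Sum>y\<in>f ` S. card {x \<in> S. f x = y})"
    using sum.image_gen[OF assms(1), of "\<lambda>_. 1::nat" f] by simp
  also have "\<dots> \<le> card (f ` S) * C"
    using sum_bounded_above[of "f ` S" "\<lambda>y. card {x \<in> S. f x = y}" C] assms(2) by simp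
  finally show ?thesis .
qed

text \<open>Sort the points by the unit square containing their projection; differences of two points
  in the same class lie in a fixed finite set.\<close>

lemma card_lattice_strip:
  fixes \<Lambda> :: "(real^(2 + 'm::finite)) set"
  assumes diff: "\<And>u v. u \<in> \<Lambda> \<Longrightarrow> v \<in> \<Lambda> \<Longrightarrow> u - v \<in> \<Lambda>"
    and fin: "\<And>S. bounded S \<Longrightarrow> finite (\<Lambda> \<inter> S)"
  shows "\<exists>C. \<forall>w\<ge>0. finite {u \<in> \<Lambda>. norm (proj u) \<le> w \<and> norm (proj_int u) \<le> c} \<and>
    real (card {u \<in> \<Lambda>. norm (proj u) \<le> w \<and> norm (proj_int u) \<le> c}) \<le> C * (w + 1)\<^sup>2"
proof -
  define E where "E w c = {u \<in> \<Lambda>. norm (proj u) \<le> w \<and> norm (proj_int u) \<le> c}" for w c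
  have finE: "finite (E w c)" for w c
  proof -
    have "norm u \<le> w + c" if "u \<in> E w c" for u
      using that norm_le_proj_proj_int[of u] by (auto simp: E_def)
    then have "E w c \<subseteq> \<Lambda> \<inter> cball 0 (w + c)"
      by (auto simp: E_def)
    then show ?thesis
      using fin[OF bounded_cball] finite_subset by blast
  qed
  \<comment> \<open>At most (2 floor(w) + 2)^2, hence at most 4 (w + 1)^2, unit squares are met. Two
    points over the same square differ by at most 1 in both planar coordinates, so by at most 2 in
    norm, and by at most \<open>2 * c\<close> internally.\<close>
  have "real (card (E w c)) \<le> (4 * real (card (E 2 (2 * c)))) * (w + 1)\<^sup>2" if w: "w \<ge> 0" for w
  proof -
    let ?f = "\<lambda>u. (\<lfloor>proj u $ 1\<rfloor>, \<lfloor>proj u $ 2\<rfloor>)"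
    have "card {u \<in> E w c. ?f u = j} \<le> card (E 2 (2 * c))" if j: "j \<in> ?f ` E w c" for j
    proof -
      obtain u0 where u0: "u0 \<in> E w c" "?f u0 = j"
        using j by blast
      have "(\<lambda>u. u - u0) ` {u \<in> E w c. ?f u = j} \<subseteq> E 2 (2 * c)"
      proof (rule image_subsetI)
        fix u assume "u \<in> {u \<in> E w c. ?f u = j}"
        then have u: "u \<in> E w c" "?f u = ?f u0"
          using u0 by auto
        then have fl: "\<lfloor>proj u $ i\<rfloor> = \<lfloor>proj u0 $ i\<rfloor>" for i
          using exhaust_2[of i] by auto
        have "\<bar>(proj u - proj u0) $ i\<bar> \<le> 1" for i
          using fl[of i] by simp linarith
        then have "norm (proj u - proj u0) \<le> (\<Sum>i::2\<in>UNIV. 1)"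
          by (intro order_trans[OF norm_le_l1_cart] sum_mono)
        moreover have "norm (proj_int u - proj_int u0) \<le> c + c"
          using u u0(1) by (intro norm_triangle_le_diff) (auto simp: E_def)
        ultimately show "u - u0 \<in> E 2 (2 * c)"
          using u u0(1) diff by (simp add: E_def proj_diff proj_int_diff)
      qed
      then show ?thesis
        by (intro card_inj_on_le[OF _ _ finE]) (auto simp: inj_on_def)
    qed
    then have "card (E w c) \<le> card (?f ` E w c) * card (E 2 (2 * c))"
      by (intro card_le_mult_fibres finE)
    moreover have "card (?f ` E w c) \<le> card ({-\<lfloor>w\<rfloor>-1..\<lfloor>w\<rfloor>} \<times> {-\<lfloor>w\<rfloor>-1..\<lfloor>w\<rfloor>})"
    proof (rule card_mono)
      have "-\<lfloor>w\<rfloor>-1 \<le> \<lfloor>proj u $ i\<rfloor> \<and> \<lfloor>proj u $ i\<rfloor> \<le> \<lfloor>w\<rfloor>" if "u \<in> E w c" for u i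
        using component_le_norm_cart[of "proj u" i] that unfolding E_def by simp linarith
      then show "?f ` E w c \<subseteq> {-\<lfloor>w\<rfloor>-1..\<lfloor>w\<rfloor>} \<times> {-\<lfloor>w\<rfloor>-1..\<lfloor>w\<rfloor>}"
        by auto
    qed auto
    moreover have "real (card ({-\<lfloor>w\<rfloor>-1..\<lfloor>w\<rfloor>} \<times> {-\<lfloor>w\<rfloor>-1..\<lfloor>w\<rfloor>})) \<le> 4 * (w + 1)\<^sup>2"
    proof -
      have "real (card {-\<lfloor>w\<rfloor>-1..\<lfloor>w\<rfloor>}) \<le> 2 * (w + 1)"
        using w by simp
      then have "(real (card {-\<lfloor>w\<rfloor>-1..\<lfloor>w\<rfloor>}))\<^sup>2 \<le> (2 * (w + 1))\<^sup>2"
        by (intro power_mono) simp_all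
      then show ?thesis
        by (simp only: card_cartesian_product of_nat_mult power2_eq_square)
    qed
    ultimately have f: "real (card (?f ` E w c)) \<le> 4 * (w + 1)\<^sup>2"
      and *: "card (E w c) \<le> card (?f ` E w c) * card (E 2 (2 * c))"
      by linarith+
    have "real (card (E w c)) \<le> real (card (?f ` E w c)) * real (card (E 2 (2 * c)))"
      using of_nat_mono[OF *, where ?'a = real] by (simp only: of_nat_mult)
    also have "\<dots> \<le> 4 * (w + 1)\<^sup>2 * real (card (E 2 (2 * c)))"
      using f by (intro mult_right_mono) auto
    finally show ?thesis
      by (simp add: mult_ac)
  qed
  then show ?thesis
    using finE[of _ c] unfolding E_def by blast
qed

subsection \<open>Points on a common ray\<close>

text \<open>Only finitely many points of \<open>Q\<close> lie on the segment from the origin to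
  \<open>p\<close>, origin excluded; the one with the smallest parameter is visible.\<close>

lemma visible_on_ray:
  assumes fin: "\<And>S. bounded S \<Longrightarrow> finite (Q \<inter> S)" and p: "p \<in> Q" "p \<noteq> 0"
  obtains t where "0 < t" "t \<le> 1" "t *\<^sub>R p \<in> visible Q"
proof -
  define A where "A = {t. 0 < t \<and> t \<le> 1 \<and> t *\<^sub>R p \<in> Q}"
  have "norm (t *\<^sub>R p) \<le> norm p" if "t \<in> A" for t
    using that by (auto simp: A_def mult_left_le_one_le)
  then have "(\<lambda>t. t *\<^sub>R p) ` A \<subseteq> Q \<inter> cball 0 (norm p)"
    by (auto simp: A_def)
  then have "finite ((\<lambda>t. t *\<^sub>R p) ` A)"
    using fin bounded_cball finite_subset by blast
  then have A: "finite A"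
    by (rule finite_imageD) (use p in \<open>auto simp: inj_on_def\<close>)
  have "1 \<in> A"
    using p by (simp add: A_def)
  define t where "t = Min A"
  have t: "t \<in> A" "\<And>s. s \<in> A \<Longrightarrow> t \<le> s"
    using Min_in[OF A] Min_le[OF A] \<open>1 \<in> A\<close> by (auto simp: t_def)
  have "t *\<^sub>R p \<in> visible Q"
    unfolding visible_def
  proof (intro CollectI conjI ballI notI)
    show "t *\<^sub>R p \<in> Q"
      using t(1) by (simp add: A_def)
    fix s :: real assume s: "s \<in> {0<..<1}" and "s *\<^sub>R t *\<^sub>R p \<in> Q"
    moreover have "0 < t" "t \<le> 1"
      using t(1) by (auto simp: A_def)
    moreover from this s have "s * t < t" "0 < s * t"
      by auto
    ultimately have "s * t \<in> A"
      by (simp add: A_def)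
    then show False
      using t(2) \<open>s * t < t\<close> by fastforce
  qed
  with t(1) that show ?thesis
    by (auto simp: A_def)
qed

lemma visible_eq_if_same_ray:
  assumes "a > 0" "b > 0" "v \<in> visible Q" "v' \<in> visible Q" "a *\<^sub>R v = b *\<^sub>R v'"
  shows "v = v'"
proof -
  \<comment> \<open>This case is contradictory: \<open>v'\<close> would be a point of
    \<open>Q\<close> strictly between the origin and \<open>v\<close>, or the origin-excluding
    multiple of \<open>v\<close> that visibility forbids.\<close>
  have *: "v = v'" if "0 < a" "a < b" "v \<in> visible Q" "v' \<in> visible Q" "a *\<^sub>R v = b *\<^sub>R v'"
    for a b :: real and v v'
  proof -
    have "v' = (a / b) *\<^sub>R v"
    proof -
      have "(1 / b) *\<^sub>R (a *\<^sub>R v) = (1 / b) *\<^sub>R (b *\<^sub>R v')"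
        using that(5) by simp
      then show ?thesis
        using that(1,2) by simp
    qed
    moreover have "a / b \<in> {0<..<1}"
      using that by simp
    ultimately show ?thesis
      using that(3,4) by (auto simp: visible_def)
  qed
  consider "a < b" | "b < a" | "a = b" by linarith
  then show ?thesis
    using *[of a b v v'] *[of b a v' v] assms by cases auto
qed

text \<open>On each ray, subtracting the shortest point of \<open>S\<close> from the others maps \<open>S\<close> injectively to
  the disjoint union of the visible points and the short differences.\<close>

lemma card_annulus_le:
  fixes Q :: "(real^2) set"
  assumes fin: "\<And>S. bounded S \<Longrightarrow> finite (Q \<inter> S)"
    and S: "S \<subseteq> Q" "0 \<notin> S" "\<And>p. p \<in> S \<Longrightarrow> a \<le> norm p \<and> norm p \<le> a + w \<and> norm p \<le> T"
    and E: "finite E" "\<And>p q. \<lbrakk>p \<in> Q; q \<in> Q; norm (p - q) \<le> w\<rbrakk> \<Longrightarrow> p - q \<in> E"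
  shows "card S \<le> card (visible Q \<inter> cball 0 T) + card E"
proof -
  have "S \<subseteq> Q \<inter> cball 0 T"
    using S by auto
  then have finS: "finite S"
    using fin bounded_cball finite_subset by blast
  have finV: "finite (visible Q \<inter> cball 0 T)"
    by (rule finite_subset[OF _ fin[OF bounded_cball]]) (auto simp: visible_def)
  have "\<exists>v c. v \<in> visible Q \<inter> cball 0 T \<and> 1 \<le> c \<and> p = c *\<^sub>R v" if "p \<in> S" for p
  proof -
    have p: "p \<in> Q" "p \<noteq> 0" "norm p \<le> T"
      using S that by auto
    obtain t where t: "0 < t" "t \<le> 1" "t *\<^sub>R p \<in> visible Q"
      using visible_on_ray[OF fin p(1,2)] by blast
    have "norm (t *\<^sub>R p) \<le> T"
      using t p(3) by (intro order_trans[OF _ p(3)]) (simp add: mult_left_le_one_le)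
    with t show ?thesis
      by (intro exI[of _ "t *\<^sub>R p"] exI[of _ "1 / t"]) auto
  qed
  then obtain f c where f: "\<And>p. p \<in> S \<Longrightarrow> f p \<in> visible Q \<inter> cball 0 T"
      and c: "\<And>p. p \<in> S \<Longrightarrow> 1 \<le> c p" and pf: "\<And>p. p \<in> S \<Longrightarrow> p = c p *\<^sub>R f p"
    by metis
  \<comment> \<open>Among the points of \<open>S\<close> on the ray of \<open>v\<close>, this is one
    with the smallest multiplier \<open>c\<close>, that is, closest to the origin.\<close>
  define q where "q v = (ARG_MIN c p. p \<in> S \<and> f p = v)" for v
  have q: "q (f p) \<in> S \<and> f (q (f p)) = f p \<and> c (q (f p)) \<le> c p" if "p \<in> S" for p
  proof -
    have "finite {p' \<in> S. f p' = f p}" "{p' \<in> S. f p' = f p} \<noteq> {}"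
      using finS that by auto
    from arg_min_if_finite[OF this, of c] arg_min_least[OF this, of p c] that show ?thesis
      unfolding q_def arg_min_on_def by (simp add: not_less)
  qed
  define h where "h p = (if p = q (f p) then Inl (f p) else Inr (p - q (f p)))" for p
  have diff: "p - q (f p) = (c p - c (q (f p))) *\<^sub>R f p" if "p \<in> S" for p
    using pf[OF that] pf[of "q (f p)"] q[OF that] by (metis scaleR_diff_left)
  have pos: "c p - c (q (f p)) > 0" if "p \<in> S" "p \<noteq> q (f p)" for p
    using q[OF that(1)] diff[OF that(1)] that(2) by (cases "c p = c (q (f p))") auto
  have "inj_on h S"
  proof (rule inj_onI)
    fix p p' assume p: "p \<in> S" "p' \<in> S" and eq: "h p = h p'"
    show "p = p'"
    proof (cases "p = q (f p)")
      case True
      then show ?thesis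
        using eq by (metis h_def sum.inject(1) sum.simps(4))
    next
      case False
      then have ne': "p' \<noteq> q (f p')" and d: "p - q (f p) = p' - q (f p')"
        using eq by (auto simp: h_def split: if_splits)
      \<comment> \<open>A difference is a positive multiple of the visible point on its ray. It
        therefore determines the ray, and with it the point that was subtracted.\<close>
      have "f p = f p'"
        using visible_eq_if_same_ray[OF pos[OF p(1) False] pos[OF p(2) ne'], of "f p" Q "f p'"]
          f[OF p(1)] f[OF p(2)] d diff[OF p(1)] diff[OF p(2)] by simp
      then show ?thesis
        using d by simp
    qed
  qed
  moreover have "h ` S \<subseteq> (visible Q \<inter> cball 0 T) <+> E"
  proof (rule image_subsetI)
    fix p assume p: "p \<in> S"
    let ?q = "q (f p)"
    have qS: "?q \<in> S" "f ?q = f p" "c ?q \<le> c p"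
      using q[OF p] by auto
    have "norm (p - ?q) = (c p - c ?q) * norm (f p)"
      using diff[OF p] qS by simp
    \<comment> \<open>On a common ray from the origin, the distance of two points is the difference
      of their norms, so it is bounded by the width of the annulus.\<close>
    also have "\<dots> = norm p - norm ?q"
    proof -
      have "norm p = c p * norm (f p)" "norm ?q = c ?q * norm (f p)"
        using arg_cong[OF pf[OF p], of norm] arg_cong[OF pf[OF qS(1)], of norm]
          c[OF p] c[OF qS(1)] qS(2) by simp_all
      then show ?thesis
        by (simp add: algebra_simps)
    qed
    also have "\<dots> \<le> w"
      using S(3)[OF p] S(3)[OF qS(1)] by linarith
    finally have "p - ?q \<in> E"
      using p qS S(1) by (intro E(2)) auto
    then show "h p \<in> (visible Q \<inter> cball 0 T) <+> E"
      using f[OF p] unfolding h_def by auto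
  qed
  ultimately have "card S \<le> card ((visible Q \<inter> cball 0 T) <+> E)"
    using finV E(1) by (intro card_inj_on_le) auto
  then show ?thesis
    using finV E(1) by (simp add: card_Plus)
qed

text \<open>Every nonzero point of the disc lies in one of \<open>K + 1\<close> annuli of width
  \<open>T / K\<close>, to each of which \<open>card_annulus_le\<close> applies. The summand 1
  allows for the origin.\<close>

lemma card_disc_le:
  fixes Q :: "(real^2) set"
  assumes fin: "\<And>S. bounded S \<Longrightarrow> finite (Q \<inter> S)"
    and E: "finite E" "\<And>p q. \<lbrakk>p \<in> Q; q \<in> Q; norm (p - q) \<le> T / K\<rbrakk> \<Longrightarrow> p - q \<in> E"
    and T: "T > 0" and K: "K > (0::nat)"
  shows "card (Q \<inter> cball 0 T) \<le> 1 + (K + 1) * (card (visible Q \<inter> cball 0 T) + card E)"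
proof -
  define S where "S j = {p \<in> Q. p \<noteq> 0 \<and> norm p \<le> T \<and> real j * (T / K) \<le> norm p \<and>
    norm p \<le> real j * (T / K) + T / K}" for j
  have "Q \<inter> cball 0 T \<subseteq> {0} \<union> (\<Union>j\<in>{..K}. S j)"
  proof
    fix p assume p: "p \<in> Q \<inter> cball 0 T"
    define j where "j = nat \<lfloor>norm p / (T / K)\<rfloor>"
    have TK: "T / K > 0"
      using T K by simp
    then have "0 \<le> norm p / (T / K)"
      using T by simp
    then have j: "real j \<le> norm p / (T / K)" "norm p / (T / K) < real j + 1"
      unfolding j_def by linarith+
    have "norm p / (T / K) \<le> real K"
      using p T K by (simp add: field_simps)
    \<comment> \<open>The index \<open>K\<close> itself occurs only for points on the boundary
      circle of the disc.\<close>
    then have "j \<le> K"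
      using j(1) by linarith
    moreover have "real j * (T / K) \<le> norm p" "norm p < (real j + 1) * (T / K)"
      using j TK by (simp_all only: pos_le_divide_eq pos_divide_less_eq)
    then have "p \<noteq> 0 \<Longrightarrow> p \<in> S j"
      using p by (simp add: S_def distrib_right del: times_divide_eq_right)
    ultimately show "p \<in> {0} \<union> (\<Union>j\<in>{..K}. S j)"
      by blast
  qed
  moreover have finS: "finite (S j)" for j
    by (rule finite_subset[OF _ fin[OF bounded_cball[of 0 T]]]) (auto simp: S_def)
  ultimately have "card (Q \<inter> cball 0 T) \<le> card ({0} \<union> (\<Union>j\<in>{..K}. S j))"
    by (intro card_mono) auto
  also have "\<dots> \<le> 1 + card (\<Union>j\<in>{..K}. S j)"
    by (metis card_Un_le is_singletonI is_singleton_altdef)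
  also have "card (\<Union>j\<in>{..K}. S j) \<le> (\<Sum>j\<in>{..K}. card (S j))"
    by (rule card_UN_le) simp
  also have "\<dots> \<le> of_nat (card {..K}) * (card (visible Q \<inter> cball 0 T) + card E)"
    by (intro sum_bounded_above card_annulus_le[OF fin _ _ _ E]) (auto simp: S_def)
  finally show ?thesis
    by simp
qed

subsection \<open>Positivity of the densities\<close>

lemma image_scaleR_cball_1:
  assumes "T > 0"
  shows "(\<lambda>y. T *\<^sub>R y) ` cball 0 1 = cball (0 :: 'a::real_normed_vector) T"
proof (intro subset_antisym subsetI)
  fix y :: 'a assume "y \<in> cball 0 T"
  then show "y \<in> (\<lambda>y. T *\<^sub>R y) ` cball 0 1"
    using assms by (intro image_eqI[of _ _ "(1 / T) *\<^sub>R y"]) auto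
qed (use assms in auto)

lemma has_constant_density_disc:
  assumes "has_constant_density Q \<theta>"
  shows "((\<lambda>T. real (card (Q \<inter> cball 0 T)) / T\<^sup>2) \<longlongrightarrow> \<theta> * measure lebesgue (cball 0 1 :: (real^2) set)) at_top"
proof -
  have "((\<lambda>T. real (card (Q \<inter> (\<lambda>y. T *\<^sub>R y) ` cball 0 1)) / T\<^sup>2)
      \<longlongrightarrow> \<theta> * measure lebesgue (cball 0 1 :: (real^2) set)) at_top"
    using assms unfolding has_constant_density_def by (auto simp: negligible_sphere)
  then show ?thesis
    by (rule Lim_transform_eventually)
       (auto intro!: eventually_mono[OF eventually_gt_at_top[of 0]] simp: image_scaleR_cball_1)
qed

lemma measure_disc_pos: "measure lebesgue (cball 0 1 :: (real^2) set) > 0"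
  using content_cball_pos[of 1 "0 :: real^2"] by simp

text \<open>The unit disc has positive area, so the limit of the normalised counts in discs
  determines the density.\<close>

lemma density_of_eq:
  assumes "has_constant_density Q \<theta>"
  shows "density_of Q = \<theta>"
  unfolding density_of_def
proof (rule the_equality[where P = "has_constant_density Q", OF assms])
  fix \<theta>' assume "has_constant_density Q \<theta>'"
  from has_constant_density_disc[OF this] has_constant_density_disc[OF assms]
  have "\<theta>' * measure lebesgue (cball 0 1 :: (real^2) set) = \<theta> * measure lebesgue (cball 0 1 :: (real^2) set)"
    by (intro tendsto_unique[rotated]) auto
  then show "\<theta>' = \<theta>"
    using measure_disc_pos by simp
qed

text \<open>Choose a point of \<open>Q\<close> within \<open>R\<close> of each node of a square grid
  of mesh 3 \<open>R\<close>. Distinct nodes receive distinct points, so the counts in discs grow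
  quadratically.\<close>

lemma density_pos_if_relatively_dense:
  assumes \<theta>: "has_constant_density Q \<theta>"
    and dense: "R > 0" "\<And>u. \<exists>p\<in>Q. norm (p - u) \<le> R"
  shows "\<theta> > 0"
proof -
  define p where "p u = (SOME p. p \<in> Q \<and> norm (p - u) \<le> R)" for u
  have p: "p u \<in> Q" "norm (p u - u) \<le> R" for u
    using someI_ex[of "\<lambda>p. p \<in> Q \<and> norm (p - u) \<le> R"] dense(2) unfolding p_def by blast+
  define u where "u = (\<lambda>(i, j). (\<chi> k. if k = 1 then 3 * R * real i else 3 * R * real j) :: real^2)"
  \<comment> \<open>By the l1 bound a node has norm at most 6 \<open>R\<close> \<open>N\<close>, and
    the chosen point is at most \<open>R\<close> away; the radius leaves room for both.\<close>
  have card: "N\<^sup>2 \<le> card (Q \<inter> cball 0 (9 * R * real (Suc N)))" for N :: nat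
  proof -
    have "inj_on (p \<circ> u) ({..<N} \<times> {..<N})"
    proof (rule inj_onI)
      fix a b assume eq: "(p \<circ> u) a = (p \<circ> u) b"
      have "norm (u a - u b) \<le> 2 * R"
        using norm_triangle_le_diff[of "p (u a) - u b" "p (u a) - u a" "2 * R"] p(2)[of "u a"] p(2)[of "u b"] eq
        by simp
      then have c: "\<bar>(u a - u b) $ k\<bar> \<le> 2 * R" for k
        using component_le_norm_cart[of "u a - u b" k] by linarith
      have *: "i = j" if "\<bar>3 * R * real i - 3 * R * real j\<bar> \<le> 2 * R" for i j
      proof (rule ccontr)
        assume "i \<noteq> j"
        then have "1 \<le> \<bar>real i - real j\<bar>"
          by linarith
        then have "3 * R * 1 \<le> 3 * R * \<bar>real i - real j\<bar>"
          using dense(1) by (intro mult_left_mono) auto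
        also have "\<dots> = \<bar>3 * R * real i - 3 * R * real j\<bar>"
          using dense(1) by (simp add: abs_mult right_diff_distrib[symmetric])
        finally show False
          using that dense(1) by linarith
      qed
      show "a = b"
        using c[of 1] c[of 2] by (cases a; cases b) (auto simp: u_def intro!: *)
    qed
    moreover have "(p \<circ> u) ` ({..<N} \<times> {..<N}) \<subseteq> Q \<inter> cball 0 (9 * R * real (Suc N))"
    proof (rule image_subsetI)
      fix a assume a: "a \<in> {..<N} \<times> {..<N}"
      then have "norm (u a) \<le> (\<Sum>k::2\<in>UNIV. 3 * R * real N)"
        using dense(1)
        by (intro order_trans[OF norm_le_l1_cart] sum_mono) (auto simp: u_def)
      then have "norm (u a) \<le> 6 * R * real N"
        by simp
      moreover have "norm (p (u a)) \<le> norm (u a) + R"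
        using p(2)[of "u a"] norm_triangle_sub[of "p (u a)" "u a"] by linarith
      moreover have "6 * R * real N + R \<le> 9 * R * real (Suc N)"
        using dense(1) by (simp add: algebra_simps)
      ultimately show "(p \<circ> u) a \<in> Q \<inter> cball 0 (9 * R * real (Suc N))"
        using p(1) by simp
    qed
    moreover have "finite (Q \<inter> cball 0 (9 * R * real (Suc N)))"
      using \<theta> bounded_cball unfolding has_constant_density_def by blast
    ultimately have "card ({..<N} \<times> {..<N}) \<le> card (Q \<inter> cball 0 (9 * R * real (Suc N)))"
      by (rule card_inj_on_le)
    then show ?thesis
      by (simp add: power2_eq_square)
  qed
  have "filterlim (\<lambda>N. 9 * R * real (Suc N)) at_top sequentially"
    using dense(1) filterlim_compose[OF filterlim_real_sequentially filterlim_Suc]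
    by (intro filterlim_tendsto_pos_mult_at_top[OF tendsto_const]) auto
  \<comment> \<open>For \<open>N\<close> at least 1 we have \<open>N + 1\<close> at most 2
    \<open>N\<close>. The radius is then at most 18 \<open>R\<close> \<open>N\<close>, while the
    disc contains at least \<open>N * N\<close> points.\<close>
  from filterlim_compose[OF has_constant_density_disc[OF \<theta>] this]
  have "1 / (18 * R)\<^sup>2 \<le> \<theta> * measure lebesgue (cball 0 1 :: (real^2) set)"
  proof (rule tendsto_lowerbound)
    show "\<forall>\<^sub>F N in sequentially. 1 / (18 * R)\<^sup>2 \<le>
        real (card (Q \<inter> cball 0 (9 * R * real (Suc N)))) / (9 * R * real (Suc N))\<^sup>2"
    proof (rule eventually_mono[OF eventually_ge_at_top[of 1]])
      fix N :: nat assume "1 \<le> N"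
      then have "(9 * R * real (Suc N))\<^sup>2 \<le> (18 * R * real N)\<^sup>2"
        using dense(1) by (intro power_mono) auto
      also have "\<dots> = (18 * R)\<^sup>2 * real (N\<^sup>2)"
        by (simp add: power2_eq_square)
      also have "\<dots> \<le> (18 * R)\<^sup>2 * real (card (Q \<inter> cball 0 (9 * R * real (Suc N))))"
        using card[of N] by (intro mult_left_mono of_nat_mono) auto
      finally show "1 / (18 * R)\<^sup>2 \<le>
          real (card (Q \<inter> cball 0 (9 * R * real (Suc N)))) / (9 * R * real (Suc N))\<^sup>2"
        using dense(1) by (simp add: divide_simps mult_ac)
    qed
  qed simp
  moreover have "0 < 1 / (18 * R)\<^sup>2"
    using dense(1) by simp
  ultimately show ?thesis
    using measure_disc_pos by (meson less_le_trans zero_less_mult_pos2)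
qed

text \<open>Apply \<open>card_disc_le\<close> with differences of length up to \<open>T / K\<close>,
  divide by the square of \<open>T\<close>, and let \<open>T\<close> tend to infinity for fixed
  \<open>K\<close>. If \<theta>' were not positive, \<theta> times the area of the disc would be at
  most a bound of order 1 / \<open>K\<close>, for every \<open>K\<close>.\<close>

lemma visible_density_pos:
  assumes \<theta>: "has_constant_density Q \<theta>" "\<theta> > 0"
    and \<theta>': "has_constant_density (visible Q) \<theta>'"
    and E: "\<And>w. w \<ge> 0 \<Longrightarrow> \<exists>E. finite E \<and> real (card E) \<le> C * (w + 1)\<^sup>2 \<and>
      (\<forall>p\<in>Q. \<forall>q\<in>Q. norm (p - q) \<le> w \<longrightarrow> p - q \<in> E)"
  shows "\<theta>' > 0"
proof (rule ccontr)
  assume neg: "\<not> \<theta>' > 0"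
  let ?V = "measure lebesgue (cball 0 1 :: (real^2) set)"
  have fin: "\<And>S. bounded S \<Longrightarrow> finite (Q \<inter> S)"
    using \<theta> unfolding has_constant_density_def by blast
  \<comment> \<open>Dividing term by term gives each term its own limit as \<open>T\<close> grows;
    with \<open>s\<close> = \<open>T / K + 1\<close> and \<open>t\<close> = \<open>T\<close> the
    last quotient tends to 1 / \<open>K\<close>.\<close>
  have split: "(1 + a * (v + C * s\<^sup>2)) / t\<^sup>2 = 1 / t\<^sup>2 + a * (v / t\<^sup>2 + C * (s / t)\<^sup>2)"
    for a v s t :: real
    by (simp add: add_divide_distrib power_divide distrib_left)
  have lim: "\<theta> * ?V \<le> (real K + 1) * (C / (real K)\<^sup>2)" if K: "K > 0" for K :: nat
  proof -
    have "\<theta> * ?V \<le> 0 + (real K + 1) * (\<theta>' * ?V + C * (1 / real K + 0)\<^sup>2)"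
    proof (rule tendsto_le[OF _ _ has_constant_density_disc[OF \<theta>(1)]])
      show "((\<lambda>T. 1 / T\<^sup>2 + (real K + 1) * (real (card (visible Q \<inter> cball 0 T)) / T\<^sup>2
            + C * (1 / real K + 1 / T)\<^sup>2)) \<longlongrightarrow>
          0 + (real K + 1) * (\<theta>' * ?V + C * (1 / real K + 0)\<^sup>2)) at_top"
        by (intro tendsto_intros has_constant_density_disc[OF \<theta>'])
           (real_asymp+)
      show "\<forall>\<^sub>F T in at_top. real (card (Q \<inter> cball 0 T)) / T\<^sup>2 \<le>
          1 / T\<^sup>2 + (real K + 1) * (real (card (visible Q \<inter> cball 0 T)) / T\<^sup>2 + C * (1 / real K + 1 / T)\<^sup>2)"
      proof (rule eventually_mono[OF eventually_gt_at_top[of 0]])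
        fix T :: real assume T: "T > 0"
        obtain E' where E': "finite E'" "real (card E') \<le> C * (T / K + 1)\<^sup>2"
            "\<And>p q. \<lbrakk>p \<in> Q; q \<in> Q; norm (p - q) \<le> T / K\<rbrakk> \<Longrightarrow> p - q \<in> E'"
          using E[of "T / K"] T by auto
        let ?v = "card (visible Q \<inter> cball 0 T)"
        have "card (Q \<inter> cball 0 T) \<le> 1 + (K + 1) * (?v + card E')"
          by (rule card_disc_le[OF fin E'(1,3) T K])
        then have "real (card (Q \<inter> cball 0 T)) \<le> 1 + (real K + 1) * (real ?v + real (card E'))"
          using of_nat_mono[where ?'a = real]
          by (simp only: of_nat_1[symmetric, where ?'a = real] of_nat_add[symmetric] of_nat_mult[symmetric])
        also have "\<dots> \<le> 1 + (real K + 1) * (real ?v + C * (T / K + 1)\<^sup>2)"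
          using E'(2) by (intro add_left_mono mult_left_mono) auto
        finally have "real (card (Q \<inter> cball 0 T)) / T\<^sup>2 \<le>
            (1 + (real K + 1) * (real ?v + C * (T / K + 1)\<^sup>2)) / T\<^sup>2"
          by (intro divide_right_mono) auto
        also have "\<dots> = 1 / T\<^sup>2 + (real K + 1) * (real ?v / T\<^sup>2 + C * ((T / K + 1) / T)\<^sup>2)"
          by (rule split)
        also have "(T / K + 1) / T = 1 / real K + 1 / T"
          using T by (simp add: add_divide_distrib)
        finally show "real (card (Q \<inter> cball 0 T)) / T\<^sup>2 \<le>
          1 / T\<^sup>2 + (real K + 1) * (real ?v / T\<^sup>2 + C * (1 / real K + 1 / T)\<^sup>2)" .
      qed
    qed simp
    also have "\<dots> = (real K + 1) * (\<theta>' * ?V + C / (real K)\<^sup>2)"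
      by (simp add: power_divide)
    also have "\<dots> \<le> (real K + 1) * (C / (real K)\<^sup>2)"
      using mult_nonpos_nonneg[of \<theta>' ?V] neg measure_disc_pos by (intro mult_left_mono) auto
    finally show ?thesis .
  qed
  have "((\<lambda>K. (real K + 1) * (C / (real K)\<^sup>2)) \<longlongrightarrow> 0) sequentially"
    by real_asymp
  then have "\<theta> * ?V \<le> 0"
    by (rule tendsto_lowerbound) (rule eventually_mono[OF eventually_gt_at_top[of 0] lim], simp_all)
  then show False
    using mult_pos_pos[OF \<theta>(2) measure_disc_pos] by linarith
qed

section \<open>Relative density and differences of cut-and-project sets\<close>

lemma vector_matrix_bounded:
  fixes A :: "real^'k^'n"
  obtains B where "B > 0" "\<And>r. norm (r v* A) \<le> B * norm r"
proof -
  have "linear (\<lambda>r. r v* A)"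
  proof (rule linearI)
    show "(b *\<^sub>R z) v* A = b *\<^sub>R (z v* A)" for b z
      by (simp add: vector_matrix_mult_def vec_eq_iff sum_distrib_left mult_ac)
  qed (simp only: vector_matrix_left_distrib)
  then show ?thesis
    using that by (metis linear_bounded_pos mult.commute)
qed

text \<open>Solve for the real coordinates \<open>r\<close> of \<open>v\<close> and round them down.
  The rounding error is bounded, and so is its image under the linear part.\<close>

lemma affine_grid_relatively_dense:
  fixes g :: "(real^'n^'n) \<times> (real^'n)"
  assumes g: "g \<in> carrier ASL" and "\<delta> > 0"
  obtains R where "R > 0" "\<And>v. \<exists>y\<in>affine_grid \<delta> g. norm (y - v) \<le> R"
proof -
  define c where "c = \<delta> powr (1 / real CARD('n))"
  have c: "c > 0"
    using \<open>\<delta> > 0\<close> by (simp add: c_def)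
  obtain B where B: "B > 0" "\<And>r. norm (r v* fst g) \<le> B * norm r"
    using vector_matrix_bounded by blast
  have "invertible (fst g)"
    using g by (simp add: ASL_def invertible_det_nz split_beta)
  then obtain N where N: "N ** fst g = mat 1"
    by (auto simp: invertible_def)
  have "\<exists>y\<in>affine_grid \<delta> g. norm (y - v) \<le> c * (B * real CARD('n))" for v
  proof -
    define r where "r = ((1 / c) *\<^sub>R v - snd g) v* N"
    have "r v* fst g = (1 / c) *\<^sub>R v - snd g"
      unfolding r_def vector_matrix_mul_assoc N by simp
    then have r: "c *\<^sub>R act r g = v"
      using c by (simp add: act_def)
    define z where "z = (\<chi> i. real_of_int \<lfloor>r $ i\<rfloor>)"
    have "norm (z - r) \<le> (\<Sum>i::'n\<in>UNIV. 1)"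
      by (intro order_trans[OF norm_le_l1_cart] sum_mono) (simp add: z_def, linarith)
    then have zr: "norm (z - r) \<le> real CARD('n)"
      by simp
    have "c *\<^sub>R act z g - c *\<^sub>R act r g = c *\<^sub>R ((z - r) v* fst g)"
      by (simp add: act_def vector_matrix_diff_distrib scaleR_diff_right scaleR_add_right)
    then have "norm (c *\<^sub>R act z g - v) = c * norm ((z - r) v* fst g)"
      using r c by simp
    also have "\<dots> \<le> c * (B * real CARD('n))"
      using c B(1) order_trans[OF B(2)[of "z - r"] mult_left_mono[OF zr, of B]]
      by (intro mult_left_mono) auto
    finally have "norm (c *\<^sub>R act z g - v) \<le> c * (B * real CARD('n))" .
    moreover have "z \<in> int_lattice"
      by (simp add: z_def int_lattice_def)
    ultimately show ?thesis
      unfolding affine_grid_def c_def[symmetric] by blast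
  qed
  with that[of "c * (B * real CARD('n))"] c B(1) show ?thesis
    by simp
qed

text \<open>Some grid point lies at bounded distance from any target above \<open>u\<close>, but its
  internal projection may miss the window by a bounded error. Density and compactness provide
  finitely many lattice vectors that correct all such errors, and these move the point by at most
  \<open>M\<close>.\<close>

lemma cut_project_relatively_dense:
  fixes g :: "(real^('d::finite + 'm::finite)^('d + 'm)) \<times> (real^('d + 'm))" and W :: "(real^'m) set"
  assumes g: "g \<in> carrier ASL" and \<delta>: "\<delta> > 0"
    and dense: "closure (proj_int ` affine_grid \<delta> g) = UNIV"
    and W: "interior W \<noteq> {}"
  obtains R where "R > 0" "\<And>u. \<exists>p\<in>cut_project W (affine_grid \<delta> g). norm (p - u) \<le> R"
proof -
  obtain w0 r where r: "r > 0" "ball w0 r \<subseteq> W"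
    using W by (meson all_not_in_conv mem_interior)
  obtain R0 where R0: "R0 > 0" "\<And>v. \<exists>y\<in>affine_grid \<delta> g. norm (y - v) \<le> R0"
    using affine_grid_relatively_dense[OF g \<delta>] by blast
  obtain y0 where y0: "y0 \<in> affine_grid \<delta> g"
    using affine_grid_nonempty by blast
  \<comment> \<open>The internal errors that adding the lattice vector \<open>u\<close> reduces to
    less than \<open>r\<close>.\<close>
  define B where "B u = {b. norm (b + proj_int u) < r}" for u :: "real^('d + 'm)"
  have "cball 0 R0 \<subseteq> (\<Union>u\<in>grid_differences \<delta> g. B u)"
  proof
    fix b :: "real^'m"
    have "proj_int y0 - b \<in> closure (proj_int ` affine_grid \<delta> g)"
      using dense by simp
    then obtain y where y: "y \<in> affine_grid \<delta> g" "dist (proj_int y) (proj_int y0 - b) < r"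
      using r(1) unfolding closure_approachable by blast
    then have "b \<in> B (y - y0)"
      by (simp add: B_def dist_norm proj_int_diff algebra_simps)
    then show "b \<in> (\<Union>u\<in>grid_differences \<delta> g. B u)"
      using affine_grid_diff[OF y(1) y0] by blast
  qed
  moreover have "open (B u)" for u
    unfolding B_def by (intro open_Collect_less continuous_intros)
  ultimately obtain F where F: "F \<subseteq> grid_differences \<delta> g" "finite F" "cball 0 R0 \<subseteq> (\<Union>u\<in>F. B u)"
    using compactE_image[OF compact_cball] by metis
  define M where "M = (\<Sum>u\<in>F. norm u)"
  have M: "norm u \<le> M" if "u \<in> F" for u
    unfolding M_def using member_le_sum[of u F norm] that F(2) by simp
  have "\<exists>p\<in>cut_project W (affine_grid \<delta> g). norm (p - u) \<le> R0 + M" for u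
  proof -
    \<comment> \<open>The target point: it projects to \<open>u\<close>, and internally to the
      centre of a ball inside the window.\<close>
    define v where "v = (\<chi> k. case k of Inl i \<Rightarrow> u $ i | Inr j \<Rightarrow> w0 $ j)"
    have v: "proj v = u" "proj_int v = w0"
      by (simp_all add: v_def proj_def proj_int_def vec_eq_iff)
    obtain y where y: "y \<in> affine_grid \<delta> g" "norm (y - v) \<le> R0"
      using R0(2) by blast
    have "proj_int (y - v) \<in> cball 0 R0"
      using norm_proj_int_le[of "y - v"] y(2) by simp
    then obtain f where f: "f \<in> F" "norm (proj_int (y - v) + proj_int f) < r"
      using F(3) unfolding B_def by blast
    have "proj_int (y + f) \<in> W"
      using f(2) r(2) by (auto simp: proj_int_add proj_int_diff v dist_norm norm_minus_commute algebra_simps subset_iff)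
    moreover have "y + f \<in> affine_grid \<delta> g"
      using affine_grid_add y(1) f(1) F(1) by blast
    moreover have "norm (proj (y + f) - u) \<le> R0 + M"
    proof -
      have "proj (y + f) - u = proj (y - v) + proj f"
        by (simp add: proj_add proj_diff v)
      also have "norm \<dots> \<le> R0 + M"
        using norm_proj_le[of "y - v"] norm_proj_le[of f] y(2) M[OF f(1)] by (intro norm_triangle_le) linarith
      finally show ?thesis .
    qed
    ultimately show ?thesis
      unfolding cut_project_def by blast
  qed
  moreover have "M \<ge> 0"
    unfolding M_def by (intro sum_nonneg) auto
  ultimately show ?thesis
    using that[of "R0 + M"] R0(1) by simp
qed

text \<open>A difference of two points lifts to a lattice vector whose internal part is at most
  twice the bound \<open>c\<close> on the window. Short differences thus come from a strip that
  \<open>card_lattice_strip\<close> counts.\<close>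

lemma card_cut_project_differences:
  fixes g :: "(real^(2 + 'm::finite)^(2 + 'm)) \<times> (real^(2 + 'm))"
  assumes g: "g \<in> carrier ASL" and \<delta>: "\<delta> > 0" and "bounded W"
  shows "\<exists>C. \<forall>w\<ge>0. \<exists>E. finite E \<and> real (card E) \<le> C * (w + 1)\<^sup>2 \<and>
      (\<forall>p\<in>cut_project W (affine_grid \<delta> g). \<forall>q\<in>cut_project W (affine_grid \<delta> g).
         norm (p - q) \<le> w \<longrightarrow> p - q \<in> E)"
proof -
  obtain c where c: "\<And>w. w \<in> W \<Longrightarrow> norm w \<le> c"
    using \<open>bounded W\<close> by (auto simp: bounded_iff)
  define E where "E w = {u \<in> grid_differences \<delta> g. norm (proj u) \<le> w \<and> norm (proj_int u) \<le> 2 * c}" for w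
  obtain C where C: "\<And>w. w \<ge> 0 \<Longrightarrow> finite (E w)" "\<And>w. w \<ge> 0 \<Longrightarrow> real (card (E w)) \<le> C * (w + 1)\<^sup>2"
    unfolding E_def
    using card_lattice_strip[OF grid_differences_diff finite_grid_differences_bounded[OF g \<delta>], of "2 * c"] by blast
  show ?thesis
  proof (intro exI[of _ C] allI impI)
    fix w :: real assume w: "w \<ge> 0"
    have "p - q \<in> proj ` E w"
      if pq: "p \<in> cut_project W (affine_grid \<delta> g)" "q \<in> cut_project W (affine_grid \<delta> g)" "norm (p - q) \<le> w"
      for p q
    proof -
      obtain y z where yz: "y \<in> affine_grid \<delta> g" "proj_int y \<in> W" "p = proj y"
          "z \<in> affine_grid \<delta> g" "proj_int z \<in> W" "q = proj z"
        using pq(1,2) unfolding cut_project_def by blast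
      have "norm (proj_int y - proj_int z) \<le> c + c"
        using c yz by (intro norm_triangle_le_diff add_mono) auto
      then have "y - z \<in> E w"
        using affine_grid_diff[OF yz(1,4)] pq(3) yz by (simp add: E_def proj_diff proj_int_diff)
      then show ?thesis
        using yz by (intro image_eqI[of _ _ "y - z"]) (simp_all add: proj_diff)
    qed
    moreover have "real (card (proj ` E w)) \<le> C * (w + 1)\<^sup>2"
      using card_image_le[OF C(1)[OF w], of proj] C(2)[OF w] by linarith
    ultimately show "\<exists>E. finite E \<and> real (card E) \<le> C * (w + 1)\<^sup>2 \<and>
      (\<forall>p\<in>cut_project W (affine_grid \<delta> g). \<forall>q\<in>cut_project W (affine_grid \<delta> g).
         norm (p - q) \<le> w \<longrightarrow> p - q \<in> E)"
      using C(1)[OF w] by blast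
  qed
qed

subsection \<open>Open conditions on the random grid\<close>

lemma affine_grid_ASL_int:
  assumes "\<gamma> \<in> ASL_int"
  shows "affine_grid \<delta> (\<gamma> \<otimes>\<^bsub>ASL\<^esub> h) \<subseteq> affine_grid \<delta> h"
  using act_int_lattice[OF _ assms] unfolding affine_grid_def act_mult by blast

text \<open>Associativity for all pairs, whatever their determinant, so that it rewrites without
  carrier conditions.\<close>

lemma ASL_mult_assoc: "a \<otimes>\<^bsub>ASL\<^esub> b \<otimes>\<^bsub>ASL\<^esub> c = a \<otimes>\<^bsub>ASL\<^esub> (b \<otimes>\<^bsub>ASL\<^esub> c)"
  by (simp add: ASL_mult matrix_mul_assoc vector_matrix_mul_assoc vector_matrix_left_distrib add.assoc)

text \<open>Pairs serve two purposes: to ask for two non-parallel points over the window, and, with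
  a condition on the first component alone, to ask for a single grid point.\<close>

definition grid_pairs ::
  "real \<Rightarrow> (real^'n^'n) \<times> (real^'n) \<Rightarrow> ((real^'n) \<times> (real^'n)) set \<Rightarrow> ((real^'n^'n) \<times> (real^'n)) set" where
  "grid_pairs \<delta> g S = {h \<in> carrier ASL. \<exists>y \<in> affine_grid \<delta> (h \<otimes>\<^bsub>ASL\<^esub> g). \<exists>y' \<in> affine_grid \<delta> (h \<otimes>\<^bsub>ASL\<^esub> g). (y, y') \<in> S}"

lemma int_invariant_grid_pairs: "int_invariant (grid_pairs \<delta> g S)"
  for g :: "(real^'n^'n) \<times> (real^'n)"
  unfolding grid_pairs_def
proof (rule int_invariantI)
  fix \<gamma> u :: "(real^'n^'n) \<times> (real^'n)" assume "\<gamma> \<in> ASL_int"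
  then have "affine_grid \<delta> (\<gamma> \<otimes>\<^bsub>ASL\<^esub> u \<otimes>\<^bsub>ASL\<^esub> g) \<subseteq> affine_grid \<delta> (u \<otimes>\<^bsub>ASL\<^esub> g)"
    using affine_grid_ASL_int by (simp add: ASL_mult_assoc)
  moreover assume "\<exists>y \<in> affine_grid \<delta> (\<gamma> \<otimes>\<^bsub>ASL\<^esub> u \<otimes>\<^bsub>ASL\<^esub> g).
    \<exists>y' \<in> affine_grid \<delta> (\<gamma> \<otimes>\<^bsub>ASL\<^esub> u \<otimes>\<^bsub>ASL\<^esub> g). (y, y') \<in> S"
  ultimately show "\<exists>y \<in> affine_grid \<delta> (u \<otimes>\<^bsub>ASL\<^esub> g). \<exists>y' \<in> affine_grid \<delta> (u \<otimes>\<^bsub>ASL\<^esub> g). (y, y') \<in> S"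
    by blast
qed

text \<open>The set is a union over pairs of fixed integer vectors, and the image of a fixed vector
  depends continuously on \<open>h\<close>.\<close>

lemma openin_grid_pairs:
  fixes g :: "(real^'n^'n) \<times> (real^'n)"
  assumes "open S"
  shows "openin (top_of_set (carrier ASL)) (grid_pairs \<delta> g S)"
proof -
  define F where "F z z' h = ((\<delta> powr (1 / real CARD('n))) *\<^sub>R act z (h \<otimes>\<^bsub>ASL\<^esub> g),
      (\<delta> powr (1 / real CARD('n))) *\<^sub>R act z' (h \<otimes>\<^bsub>ASL\<^esub> g))" for z z' h
  have "openin (top_of_set (carrier ASL)) (carrier ASL \<inter> F z z' -` S)" for z z'
    unfolding F_def
    by (intro continuous_openin_preimage_gen assms continuous_on_Pair continuous_on_scaleR
        continuous_on_const continuous_on_act)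
  then have "openin (top_of_set (carrier ASL))
      (\<Union>z\<in>int_lattice. \<Union>z'\<in>int_lattice. carrier ASL \<inter> F z z' -` S)"
    by blast
  moreover have "(\<Union>z\<in>int_lattice. \<Union>z'\<in>int_lattice. carrier ASL \<inter> F z z' -` S) = grid_pairs \<delta> g S"
    unfolding grid_pairs_def affine_grid_def F_def by auto
  ultimately show ?thesis
    by simp
qed

section \<open>Grids with prescribed points\<close>

lemma vector_matrix_axis: "axis k 1 v* M = M $ k" for M :: "real^'n^'k"
  by (simp add: vector_matrix_mult_def vec_eq_iff axis_def mult_delta_left mult_delta_right)

lemma axis_in_int_lattice: "axis k 1 \<in> int_lattice"
  by (simp add: int_lattice_def axis_def)

text \<open>Complete \<open>a\<close> and \<open>b\<close> by the unit vectors of the internal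
  coordinates. The kernel is trivial, since its internal coordinates vanish and Cramer's rule
  handles the other two. Rescaling an internal row then makes the determinant 1 and leaves
  \<open>a\<close> and \<open>b\<close> alone.\<close>

lemma SL_with_two_rows:
  fixes a b :: "real^(2 + 'm::finite)"
  assumes ab: "proj a $ 1 * proj b $ 2 - proj a $ 2 * proj b $ 1 \<noteq> 0"
  obtains M :: "real^(2 + 'm)^(2 + 'm)" where "det M = 1" "M $ Inl 1 = a" "M $ Inl 2 = b"
proof -
  define M0 :: "real^(2 + 'm)^(2 + 'm)"
    where "M0 = (\<chi> i. case i of Inl k \<Rightarrow> if k = 1 then a else b | Inr j \<Rightarrow> axis (Inr j) 1)"
  have "x = 0" if x: "M0 *v x = 0" for x
  proof -
    have s: "(\<Sum>j\<in>UNIV. f j) = f (Inl 1) + f (Inl 2) + (\<Sum>j\<in>UNIV. f (Inr j))"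
      for f :: "2 + 'm \<Rightarrow> real"
      unfolding UNIV_Plus_UNIV[symmetric] by (subst sum.Plus) (auto simp: o_def sum_2)
    have r: "x $ Inr j = 0" for j
      using arg_cong[OF x, of "\<lambda>v. v $ Inr j"]
      by (simp add: matrix_vector_mult_def M0_def axis_def if_distrib if_distribR cong: if_cong)
    have e: "proj a $ 1 * x $ Inl 1 + proj a $ 2 * x $ Inl 2 = 0"
      "proj b $ 1 * x $ Inl 1 + proj b $ 2 * x $ Inl 2 = 0"
      using arg_cong[OF x, of "\<lambda>v. v $ Inl 1"] arg_cong[OF x, of "\<lambda>v. v $ Inl 2"]
      by (simp_all add: matrix_vector_mult_def M0_def s r proj_def)
    have "(proj a $ 1 * proj b $ 2 - proj a $ 2 * proj b $ 1) * x $ Inl 1 = 0"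
      "(proj a $ 1 * proj b $ 2 - proj a $ 2 * proj b $ 1) * x $ Inl 2 = 0"
      using e by algebra+
    then have l: "x $ Inl k = 0" for k :: 2
      using ab exhaust_2[of k] by auto
    show ?thesis
    proof (rule vec_eq_iff[THEN iffD2, rule_format])
      show "x $ i = 0 $ i" for i
        by (cases i) (use r l in auto)
    qed
  qed
  then have det0: "det M0 \<noteq> 0"
    using matrix_left_invertible_ker[of M0] invertible_det_nz[of M0] invertible_left_inverse[of M0] by blast
  \<comment> \<open>Any internal index will do, and one exists because types are nonempty.\<close>
  define k :: "2 + 'm" where "k = Inr undefined"
  define M where "M = (\<chi> i. if i = k then (1 / det M0) *s (M0 $ i) else M0 $ i)"
  have "(\<chi> i. if i = k then M0 $ i else M0 $ i) = M0"
    by (simp add: vec_eq_iff)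
  then have "det M = 1"
    using det_row_mul[of k "1 / det M0" "\<lambda>i. M0 $ i" "\<lambda>i. M0 $ i"] det0 by (simp add: M_def)
  moreover have "M $ Inl 1 = a" "M $ Inl 2 = b"
    by (simp_all add: M_def k_def M0_def)
  ultimately show ?thesis
    using that by blast
qed

text \<open>Elements of SL(n) can give the product with \<open>g\<close> any linear part of
  determinant 1, but they keep its translation part.\<close>

lemma SL_translate:
  fixes g :: "(real^'n^'n) \<times> (real^'n)"
  assumes g: "g \<in> carrier ASL" and M: "det M = 1"
  obtains h where "h \<in> SL_in_ASL" "h \<otimes>\<^bsub>ASL\<^esub> g = (M, snd g)"
proof -
  have dg: "det (fst g) = 1"
    using g by (simp add: ASL_carrier)
  then obtain N where N: "N ** fst g = mat 1"
    using invertible_det_nz[of "fst g"] by (auto simp: invertible_def)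
  then have "det N = 1"
    using dg by (metis det_I det_mul mult.right_neutral)
  then have "(M ** N, 0) \<in> SL_in_ASL"
    using M by (auto simp: SL_in_ASL_def det_mul)
  moreover have "(M ** N, 0) \<otimes>\<^bsub>ASL\<^esub> g = (M, snd g)"
    by (simp add: ASL_mult matrix_mul_assoc[symmetric] N)
  ultimately show ?thesis
    using that by blast
qed

text \<open>The image of a unit vector; prescribing rows of the matrix therefore prescribes points
  of the grid.\<close>

lemma row_in_affine_grid:
  fixes M :: "real^'n^'n"
  shows "(\<delta> powr (1 / real CARD('n))) *\<^sub>R (M $ k + \<xi>) \<in> affine_grid \<delta> (M, \<xi>)"
  using axis_in_int_lattice[of k] vector_matrix_axis[of k M]
  unfolding affine_grid_def act_def by (intro image_eqI[of _ _ "axis k 1"]) auto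

lemma proj_int_block_diag: "proj_int (y v* block_diag A) = proj_int y"
  for y :: "real^('d::finite + 'm::finite)"
proof -
  have "(\<Sum>i\<in>UNIV. block_diag A $ i $ Inr j * y $ i) = y $ Inr j" for j :: 'm
    unfolding UNIV_Plus_UNIV[symmetric]
    by (subst sum.Plus) (auto simp: o_def block_diag_def if_distrib if_distribR cong: if_cong)
  then show ?thesis
    by (simp add: proj_int_def vector_matrix_mult_def vec_eq_iff mult.commute)
qed

text \<open>The internal projection of the grid is unchanged along the orbit of \<open>SL(d)\<close>, the orbit is
  dense, and having internal projection in a closed set is a closed condition on the grid.\<close>

lemma proj_int_ratner_orbit:
  fixes g :: "(real^('d::finite + 'm::finite)^('d + 'm)) \<times> (real^('d + 'm))"
  assumes g: "g \<in> carrier ASL" and H: "ratner_group g H" and h: "h \<in> H"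
  shows "proj_int ` affine_grid \<delta> (h \<otimes>\<^bsub>ASL\<^esub> g) \<subseteq> internal_closure (affine_grid \<delta> g)"
proof (rule ccontr)
  let ?A = "internal_closure (affine_grid \<delta> g)"
  let ?T = "coset_topology ASL_int (carrier ASL) :: ((real^('d + 'm)^('d + 'm)) \<times> (real^('d + 'm))) set topology"
  assume "\<not> proj_int ` affine_grid \<delta> (h \<otimes>\<^bsub>ASL\<^esub> g) \<subseteq> ?A"
  then obtain y where y: "y \<in> affine_grid \<delta> (h \<otimes>\<^bsub>ASL\<^esub> g)" "proj_int y \<notin> ?A"
    by blast
  have Hc: "H \<subseteq> carrier ASL"
    using H subgroup.subset unfolding ratner_group_def by blast
  define S :: "((real^('d + 'm)) \<times> (real^('d + 'm))) set" where "S = {p. proj_int (fst p) \<in> - ?A}"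
  have "open (- ?A)"
    by (simp add: internal_closure_def open_Compl)
  then have "open ((\<lambda>p :: (real^('d + 'm)) \<times> (real^('d + 'm)). proj_int (fst p)) -` (- ?A))"
    by (rule open_vimage) (intro continuous_intros)
  then have S: "open S"
    by (simp add: S_def vimage_def)
  let ?U = "grid_pairs \<delta> g S"
  have Uc: "?U \<subseteq> carrier ASL"
    by (auto simp: grid_pairs_def)
  have "h \<in> ?U"
    using y h Hc unfolding grid_pairs_def S_def by auto
  then have "ASL_int #>\<^bsub>ASL\<^esub> h \<in> coset_set ASL_int ?U"
    by (auto simp: coset_set_def)
  moreover have "openin ?T (coset_set ASL_int ?U)"
    by (intro openin_coset_set openin_grid_pairs int_invariant_grid_pairs S)
  moreover have "ASL_int #>\<^bsub>ASL\<^esub> h \<in> ?T closure_of coset_set ASL_int (phi g ` {A :: real^'d^'d. det A = 1})"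
    using H h unfolding ratner_group_def by (auto simp: coset_set_def)
  ultimately obtain c where c: "c \<in> coset_set ASL_int (phi g ` {A :: real^'d^'d. det A = 1})"
      "c \<in> coset_set ASL_int ?U"
    unfolding in_closure_of by blast
  then obtain A :: "real^'d^'d" where A: "det A = 1" "ASL_int #>\<^bsub>ASL\<^esub> phi g A \<in> coset_set ASL_int ?U"
    by (auto simp: coset_set_def)
  have "phi g A \<in> carrier ASL"
    using H Hc A(1) unfolding ratner_group_def by blast
  then have "phi g A \<in> ?U"
    using A(2) coset_in_coset_set_iff[OF Uc int_invariant_grid_pairs] by blast
  \<comment> \<open>The inverse of \<open>g\<close> inside \<open>phi\<close> cancels, so the new
    grid is the old one moved by a block matrix, which fixes internal coordinates.\<close>
  moreover have "phi g A \<otimes>\<^bsub>ASL\<^esub> g = g \<otimes>\<^bsub>ASL\<^esub> (block_diag A, 0)"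
  proof -
    have "phi g A \<otimes>\<^bsub>ASL\<^esub> g = g \<otimes>\<^bsub>ASL\<^esub> (block_diag A, 0) \<otimes>\<^bsub>ASL\<^esub> \<one>\<^bsub>ASL\<^esub>"
      using group.l_inv[OF group_ASL g] by (simp add: phi_def ASL_mult_assoc)
    then show ?thesis
      by (simp add: ASL_def split_beta)
  qed
  ultimately obtain y' where y': "y' \<in> affine_grid \<delta> (g \<otimes>\<^bsub>ASL\<^esub> (block_diag A, 0))" "proj_int y' \<notin> ?A"
    by (auto simp: grid_pairs_def S_def)
  then obtain z where z: "z \<in> int_lattice"
      "y' = (\<delta> powr (1 / real CARD('d + 'm))) *\<^sub>R (act z g v* block_diag A)"
    unfolding affine_grid_def act_mult by (auto simp: act_def[of _ "(block_diag A, 0)"])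
  have "proj_int y' = proj_int ((\<delta> powr (1 / real CARD('d + 'm))) *\<^sub>R act z g)"
    using proj_int_block_diag[of "act z g" A] z(2) by (simp add: proj_int_def vec_eq_iff)
  also have "\<dots> \<in> ?A"
    unfolding internal_closure_def affine_grid_def using z(1) by (intro subsetD[OF closure_subset]) auto
  finally show False
    using y'(2) by simp
qed

text \<open>For each \<open>w\<close> some element of SL(n) produces a grid with a point exactly
  above \<open>w\<close>; by \<open>proj_int_ratner_orbit\<close> that point's internal projection
  lies in the closure for \<open>g\<close>.\<close>

lemma internal_closure_eq_UNIV:
  fixes g :: "(real^(2 + 'm::finite)^(2 + 'm)) \<times> (real^(2 + 'm))"
  assumes g: "g \<in> carrier ASL" and \<delta>: "\<delta> > 0"
    and H: "ratner_group g H" "SL_in_ASL \<subseteq> H"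
  shows "internal_closure (affine_grid \<delta> g) = UNIV"
proof (intro subset_antisym subset_UNIV subsetI)
  fix w :: "real^'m"
  define c where "c = \<delta> powr (1 / real CARD(2 + 'm))"
  have c: "c > 0"
    using \<delta> by (simp add: c_def)
  \<comment> \<open>The internal part of \<open>a\<close> is chosen so that translating by
    \<open>snd g\<close> and scaling by \<open>c\<close> gives \<open>w\<close>. The planar parts of
    \<open>a\<close> and \<open>b\<close> are the standard basis, with determinant 1.\<close>
  define a :: "real^(2 + 'm)" where
    "a = (\<chi> i. case i of Inl k \<Rightarrow> if k = 1 then 1 else 0 | Inr j \<Rightarrow> w $ j / c - snd g $ Inr j)"
  define b :: "real^(2 + 'm)" where "b = axis (Inl 2) 1"
  have "proj a $ 1 * proj b $ 2 - proj a $ 2 * proj b $ 1 \<noteq> 0"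
    by (simp add: a_def b_def proj_def axis_def)
  then obtain M :: "real^(2 + 'm)^(2 + 'm)" where M: "det M = 1" "M $ Inl 1 = a"
    by (rule SL_with_two_rows)
  obtain h where h: "h \<in> SL_in_ASL" "h \<otimes>\<^bsub>ASL\<^esub> g = (M, snd g)"
    using SL_translate[OF g M(1)] by blast
  have "c *\<^sub>R (a + snd g) \<in> affine_grid \<delta> (h \<otimes>\<^bsub>ASL\<^esub> g)"
    using row_in_affine_grid[of \<delta> M "Inl 1" "snd g"] M(2) by (simp add: h(2) c_def)
  moreover have "proj_int (c *\<^sub>R (a + snd g)) = w"
    using c by (simp add: a_def proj_int_def vec_eq_iff)
  ultimately show "w \<in> internal_closure (affine_grid \<delta> g)"
    using proj_int_ratner_orbit[OF g H(1), of h \<delta>] h(1) H(2) by blast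
qed

subsection \<open>Two visible points in the cone\<close>

abbreviation planar_det :: "real^2 \<Rightarrow> real^2 \<Rightarrow> real" where
  "planar_det u v \<equiv> u $ 1 * v $ 2 - u $ 2 * v $ 1"

text \<open>Writing non-parallelism as a nonvanishing determinant makes it an open
  condition.\<close>

definition good_pairs :: "(real^2) set \<Rightarrow> (real^'m::finite) set \<Rightarrow> ((real^(2 + 'm)) \<times> (real^(2 + 'm))) set" where
  "good_pairs K W = {(y, y'). proj y \<in> K \<and> proj y' \<in> K \<and> proj_int y \<in> W \<and> proj_int y' \<in> W \<and>
     planar_det (proj y) (proj y') \<noteq> 0}"

lemma open_good_pairs:
  assumes "open K" "open W"
  shows "open (good_pairs K W)"
proof -
  have "good_pairs K W = (\<lambda>p. proj (fst p)) -` K \<inter> (\<lambda>p. proj (snd p)) -` K \<inter>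
      (\<lambda>p. proj_int (fst p)) -` W \<inter> (\<lambda>p. proj_int (snd p)) -` W \<inter>
      {p. planar_det (proj (fst p)) (proj (snd p)) \<noteq> 0}"
    by (auto simp: good_pairs_def)
  then show ?thesis
    using assms by (auto intro!: open_Int open_vimage open_Collect_neq continuous_intros)
qed

lemma open_cone: "open (cone \<theta> \<sigma>)"
proof -
  have "open ({x :: real^2. 0 < x $ 1} \<inter> {x. x $ 1 < 1} \<inter> {x. \<bar>x $ 2\<bar> < s * x $ 1})" for s
    by (intro open_Int open_Collect_less continuous_intros)
  moreover have "cone \<theta> \<sigma> = {x. 0 < x $ 1} \<inter> {x. x $ 1 < 1} \<inter> {x. \<bar>x $ 2\<bar> < \<sigma> / \<theta> * x $ 1}"
    by (auto simp: cone_def)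
  ultimately show ?thesis
    by (simp only:)
qed

lemma cone_scaleR:
  assumes "p \<in> cone \<theta> \<sigma>" "0 < t" "t \<le> 1"
  shows "t *\<^sub>R p \<in> cone \<theta> \<sigma>"
proof -
  have "t * p $ 1 < 1"
    using assms by (intro le_less_trans[OF mult_left_le_one_le, of "p $ 1"]) (auto simp: cone_def)
  moreover have "t * \<bar>p $ 2\<bar> < t * (\<sigma> / \<theta> * p $ 1)"
    using assms by (intro mult_strict_left_mono) (auto simp: cone_def)
  ultimately show ?thesis
    using assms by (simp add: cone_def abs_mult mult_ac)
qed

text \<open>Take two points \<open>y 0\<close> and \<open>y \<beta>\<close> above one window point,
  undo scaling and translation to obtain \<open>a 0\<close> and \<open>a \<beta>\<close>, and make
  these the first two rows of a matrix.\<close>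

lemma grid_pairs_meets_SL:
  fixes g :: "(real^(2 + 'm::finite)^(2 + 'm)) \<times> (real^(2 + 'm))"
  assumes g: "g \<in> carrier ASL" and \<delta>: "\<delta> > 0" and W: "W \<noteq> {}" and s: "\<sigma> / \<theta> > 0"
  shows "grid_pairs \<delta> g (good_pairs (cone \<theta> \<sigma>) W) \<inter> SL_in_ASL \<noteq> {}"
proof -
  define c where "c = \<delta> powr (1 / real CARD(2 + 'm))"
  have c: "c > 0"
    using \<delta> by (simp add: c_def)
  obtain w where w: "w \<in> W"
    using W by blast
  \<comment> \<open>Besides lying in (0, 1), \<alpha> must avoid one value: the planar determinant
    of \<open>a 0\<close> and \<open>a \<beta>\<close> has the factor
    \<open>\<alpha> - c * snd g $ Inl 1\<close>.\<close>
  define \<alpha> :: real where "\<alpha> = (if c * snd g $ Inl 1 = 1/2 then 1/3 else 1/2)"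
  have \<alpha>: "0 < \<alpha>" "\<alpha> < 1" "\<alpha> \<noteq> c * snd g $ Inl 1"
    by (auto simp: \<alpha>_def)
  \<comment> \<open>Half the height of the cone at abscissa \<alpha>.\<close>
  define \<beta> where "\<beta> = \<sigma> / \<theta> * \<alpha> / 2"
  have \<beta>: "0 < \<beta>" "\<beta> < \<sigma> / \<theta> * \<alpha>"
    using half_gt_zero[OF mult_pos_pos[OF s \<alpha>(1)]] field_sum_of_halves[of "\<sigma> / \<theta> * \<alpha>"]
    unfolding \<beta>_def by (simp_all only:)
  define y :: "real \<Rightarrow> real^(2 + 'm)" where "y b = (\<chi> i. case i of Inl k \<Rightarrow> if k = 1 then \<alpha> else b | Inr j \<Rightarrow> w $ j)" for b
  have y: "proj (y b) $ 1 = \<alpha>" "proj (y b) $ 2 = b" "proj_int (y b) = w" for b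
    by (simp_all add: y_def proj_def proj_int_def vec_eq_iff)
  define a where "a b = (1 / c) *\<^sub>R y b - snd g" for b
  have pa: "proj (a b) $ 1 = (\<alpha> - c * snd g $ Inl 1) / c" "proj (a b) $ 2 = b / c - snd g $ Inl 2" for b
    using c by (simp_all add: a_def y_def proj_def field_simps)
  have "t * (\<beta> / c - u) - (0 / c - u) * t = t * (\<beta> / c)" for t u :: real
    by (simp add: right_diff_distrib)
  then have "planar_det (proj (a 0)) (proj (a \<beta>)) = (\<alpha> - c * snd g $ Inl 1) / c * (\<beta> / c)"
    unfolding pa .
  then have "planar_det (proj (a 0)) (proj (a \<beta>)) \<noteq> 0"
    using c \<alpha> \<beta> by simp
  then obtain M :: "real^(2 + 'm)^(2 + 'm)" where M: "det M = 1" "M $ Inl 1 = a 0" "M $ Inl 2 = a \<beta>"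
    by (rule SL_with_two_rows)
  obtain h where h: "h \<in> SL_in_ASL" "h \<otimes>\<^bsub>ASL\<^esub> g = (M, snd g)"
    using SL_translate[OF g M(1)] by blast
  have ya: "y b = c *\<^sub>R (a b + snd g)" for b
    using c by (simp add: a_def)
  have "y 0 \<in> affine_grid \<delta> (h \<otimes>\<^bsub>ASL\<^esub> g)" "y \<beta> \<in> affine_grid \<delta> (h \<otimes>\<^bsub>ASL\<^esub> g)"
    using row_in_affine_grid[of \<delta> M "Inl 1" "snd g"] row_in_affine_grid[of \<delta> M "Inl 2" "snd g"] M(2,3)
    by (simp_all only: h(2) ya c_def)
  moreover have "(y 0, y \<beta>) \<in> good_pairs (cone \<theta> \<sigma>) W"
    using \<alpha> \<beta> w s by (simp add: good_pairs_def cone_def y)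
  moreover have "h \<in> carrier ASL"
    using h(1) by (auto simp: SL_in_ASL_def ASL_carrier)
  ultimately show ?thesis
    using h(1) unfolding grid_pairs_def by blast
qed

text \<open>The visible points on the rays of the two projections remain in the cone by
  \<open>cone_scaleR\<close>. They differ because their determinant is a positive multiple of a
  nonzero one.\<close>

lemma two_visible_points:
  fixes g :: "(real^(2 + 'm::finite)^(2 + 'm)) \<times> (real^(2 + 'm))"
  assumes g: "g \<in> carrier ASL" and \<delta>: "\<delta> > 0" and W: "bounded W"
    and h: "h \<in> grid_pairs \<delta> g (good_pairs (cone \<theta> \<sigma>) (interior W))"
    and V: "V = visible (cut_project W (affine_grid \<delta> (h \<otimes>\<^bsub>ASL\<^esub> g))) \<inter> cone \<theta> \<sigma>"
  shows "\<not> (finite V \<and> card V \<le> 1)"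
proof -
  let ?P = "cut_project W (affine_grid \<delta> (h \<otimes>\<^bsub>ASL\<^esub> g))"
  have "h \<otimes>\<^bsub>ASL\<^esub> g \<in> carrier ASL"
    using g h by (simp add: grid_pairs_def ASL_carrier ASL_mult det_mul)
  then have fin: "\<And>S. bounded S \<Longrightarrow> finite (?P \<inter> S)"
    using finite_cut_project_bounded \<delta> W by blast
  obtain y y' where y: "y \<in> affine_grid \<delta> (h \<otimes>\<^bsub>ASL\<^esub> g)" "y' \<in> affine_grid \<delta> (h \<otimes>\<^bsub>ASL\<^esub> g)"
      "(y, y') \<in> good_pairs (cone \<theta> \<sigma>) (interior W)"
    using h unfolding grid_pairs_def by blast
  have p: "proj y \<in> ?P" "proj y' \<in> ?P" "proj y \<in> cone \<theta> \<sigma>" "proj y' \<in> cone \<theta> \<sigma>"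
    and ne: "planar_det (proj y) (proj y') \<noteq> 0"
    using y interior_subset unfolding good_pairs_def cut_project_def by blast+
  have nz: "proj y \<noteq> 0" "proj y' \<noteq> 0"
    using ne by auto
  obtain t where t: "0 < t" "t \<le> 1" "t *\<^sub>R proj y \<in> visible ?P"
    using visible_on_ray[OF fin p(1) nz(1)] by blast
  obtain t' where t': "0 < t'" "t' \<le> 1" "t' *\<^sub>R proj y' \<in> visible ?P"
    using visible_on_ray[OF fin p(2) nz(2)] by blast
  have V2: "t *\<^sub>R proj y \<in> V" "t' *\<^sub>R proj y' \<in> V"
    using t t' p cone_scaleR unfolding V by blast+
  have "t *\<^sub>R proj y \<noteq> t' *\<^sub>R proj y'"
  proof
    assume eq: "t *\<^sub>R proj y = t' *\<^sub>R proj y'"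
    have "t * t' * planar_det (proj y) (proj y') = planar_det (t *\<^sub>R proj y) (t' *\<^sub>R proj y')"
      by (simp add: algebra_simps)
    also have "\<dots> = 0"
      unfolding eq by simp
    finally show False
      using t t' ne by simp
  qed
  with V2 show ?thesis
    using card_le_Suc0_iff_eq[of V] by auto
qed

theorem mainTheorem7:
  fixes L0 :: "(real^(2 + 'm::finite)) set" and x :: "real^(2 + 'm)"
    and W :: "(real^'m) set" and \<delta> :: real
    and g :: "(real^(2 + 'm)^(2 + 'm)) \<times> (real^(2 + 'm))"
    and H :: "((real^(2 + 'm)^(2 + 'm)) \<times> (real^(2 + 'm))) set"
    and \<mu> :: "((real^(2 + 'm)^(2 + 'm)) \<times> (real^(2 + 'm))) set measure"
  assumes "full_rank_lattice L0"
    and "g \<in> carrier ASL" and "\<delta> > 0"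
    and "(\<lambda>y. y + x) ` L0 = affine_grid \<delta> g"
    and "admissible_window L0 x W"
    and "regular_window L0 x W"
    and "\<exists>\<theta>. has_constant_density (cut_project W (affine_grid \<delta> g)) \<theta>"
    and "\<exists>\<theta>. has_constant_density (visible (cut_project W (affine_grid \<delta> g))) \<theta>"
    and "ratner_group g H"
    and "is_ratner_measure H \<mu>"
    and "H = SL_in_ASL \<or> H = carrier ASL"
  shows "m_visible W \<delta> g H \<mu> = 0"
proof -
  let ?P = "cut_project W (affine_grid \<delta> g)"
  note g = \<open>g \<in> carrier ASL\<close> and \<delta> = \<open>\<delta> > 0\<close>
  have H: "subgroup H ASL"
    using \<open>ratner_group g H\<close> by (simp add: ratner_group_def)
  have SLH: "SL_in_ASL \<subseteq> H"
    using assms(11) by (auto simp: SL_in_ASL_def ASL_carrier)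
  have A: "internal_closure (affine_grid \<delta> g) = UNIV"
    by (rule internal_closure_eq_UNIV[OF g \<delta> \<open>ratner_group g H\<close> SLH])
  \<comment> \<open>As the internal closure is the whole space, the relative interior of the window
    is its ordinary interior.\<close>
  then have W: "bounded W" "interior W \<noteq> {}"
    using assms(5) unfolding admissible_window_def assms(4) by (simp_all add: Let_def)
  obtain \<theta> where \<theta>: "has_constant_density ?P \<theta>"
    using assms(7) by blast
  obtain \<theta>' where \<theta>': "has_constant_density (visible ?P) \<theta>'"
    using assms(8) by blast
  obtain R where "R > 0" "\<And>u. \<exists>p\<in>?P. norm (p - u) \<le> R"
    using cut_project_relatively_dense[OF g \<delta> _ W(2)] A unfolding internal_closure_def by blast
  from density_pos_if_relatively_dense[OF \<theta> this] have \<theta>_pos: "\<theta> > 0" .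
  obtain C where C: "\<And>w. w \<ge> 0 \<Longrightarrow> \<exists>E. finite E \<and> real (card E) \<le> C * (w + 1)\<^sup>2 \<and>
      (\<forall>p\<in>?P. \<forall>q\<in>?P. norm (p - q) \<le> w \<longrightarrow> p - q \<in> E)"
    using card_cut_project_differences[OF g \<delta> W(1)] by blast
  have \<theta>'_pos: "\<theta>' > 0"
    by (rule visible_density_pos[OF \<theta> \<theta>_pos \<theta>' C])
  \<comment> \<open>By the definition of \<open>kappa\<close> this slope is \<sigma> / \<theta>', so
    both densities must be known to be positive.\<close>
  have slope: "inverse (kappa ?P) * \<sigma> / density_of ?P > 0" if "\<sigma> > 0" for \<sigma>
    using that \<theta>_pos \<theta>'_pos by (simp add: kappa_def density_of_eq[OF \<theta>] density_of_eq[OF \<theta>'])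
  define Q where "Q \<sigma> x \<longleftrightarrow> (\<forall>h\<in>H. x = ASL_int #>\<^bsub>ASL\<^esub> h \<longrightarrow>
      (let V = visible (cut_project W (affine_grid \<delta> (h \<otimes>\<^bsub>ASL\<^esub> g)))
                 \<inter> cone (density_of ?P) (inverse (kappa ?P) * \<sigma>)
       in finite V \<and> card V \<le> 1))" for \<sigma> x
  have not_AE: "\<not> (AE x in \<mu>. Q \<sigma> x)" if "\<sigma> > 0" for \<sigma>
  proof
    let ?U = "grid_pairs \<delta> g (good_pairs (cone (density_of ?P) (inverse (kappa ?P) * \<sigma>)) (interior W))"
    let ?E = "coset_set ASL_int ?U \<inter> coset_set ASL_int H"
    have Uc: "?U \<subseteq> carrier ASL"
      by (auto simp: grid_pairs_def)
    assume "AE x in \<mu>. Q \<sigma> x"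
    then obtain N where N: "N \<in> null_sets \<mu>" "{x \<in> space \<mu>. \<not> Q \<sigma> x} \<subseteq> N"
      by (auto simp: eventually_ae_filter)
    have open_U: "openin (top_of_set (carrier ASL)) ?U"
      by (intro openin_grid_pairs open_good_pairs open_cone open_interior)
    have inv: "invariant_prob (subtopology (coset_topology ASL_int (carrier ASL)) (coset_set ASL_int H)) H \<mu>"
      using \<open>is_ratner_measure H \<mu>\<close> by (simp add: is_ratner_measure_def)
    have E: "?E \<in> sets \<mu>"
    proof -
      have "openin (coset_topology ASL_int (carrier ASL)) (coset_set ASL_int ?U)"
        by (intro openin_coset_set open_U int_invariant_grid_pairs)
      then show ?thesis
        using inv openin_subtopology_Int unfolding invariant_prob_def by fastforce
    qed
    \<comment> \<open>By saturation every representative of such a coset lies in \<open>?U\<close>,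
      so its grid has two visible points in the cone.\<close>
    have "?E \<subseteq> {x \<in> space \<mu>. \<not> Q \<sigma> x}"
    proof
      fix x assume x: "x \<in> ?E"
      then obtain h where h: "h \<in> H" "x = ASL_int #>\<^bsub>ASL\<^esub> h"
        by (auto simp: coset_set_def)
      have "h \<in> carrier ASL"
        using h(1) subgroup.subset[OF H] by blast
      then have "h \<in> ?U"
        using x h(2) coset_in_coset_set_iff[OF Uc int_invariant_grid_pairs] by blast
      then have "\<not> Q \<sigma> x"
        using two_visible_points[OF g \<delta> W(1) _ refl] h unfolding Q_def Let_def by blast
      then show "x \<in> {x \<in> space \<mu>. \<not> Q \<sigma> x}"
        using x sets.sets_into_space[OF E] by blast
    qed
    then have "?E \<in> null_sets \<mu>"
      using N E null_sets_subset by blast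
    moreover have "?U \<inter> H \<noteq> {}"
      using grid_pairs_meets_SL[OF g \<delta> W(2) slope[OF that]] SLH by blast
    ultimately show False
      using invariant_prob_open_not_null[OF inv H open_U int_invariant_grid_pairs] by blast
  qed
  \<comment> \<open>For \<sigma> = 0 the cone is empty. Hence 0 is admissible and the supremum is
    taken over a nonempty set.\<close>
  have "Q 0 x" for x
    unfolding Q_def by (simp add: cone_def)
  then have "{\<sigma>. 0 \<le> \<sigma> \<and> (AE x in \<mu>. Q \<sigma> x)} = {0}"
    using not_AE by (auto simp: order.order_iff_strict)
  then have "{ereal \<sigma> |\<sigma>. 0 \<le> \<sigma> \<and> (AE x in \<mu>. Q \<sigma> x)} = {0}"
    by (auto simp: zero_ereal_def set_eq_iff)
  then show ?thesis
    unfolding m_visible_def Let_def Q_def by simp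
qed

end
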